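(* For any probability measures $\mu,\nu$ on $\mathbf{T}$ with finite logarithmic energy, $$\mathcal{W}_1^{2}(\mu,\nu)\le 2\,\mathcal{H}(\mu,\nu),$$ and equality is not attained when $\mu\neq\nu$. In particular, for any continuous potential $Q:\mathbf{T}\to\mathbb{R}$ and any probability measure $\mu$ on $\mathbf{T}$, $$\mathcal{W}_1^{2}(\mu,\mu_Q)\le 2\big(E_Q(\mu)-E_Q(\mu_Q)\big).$$
   Context: $\mathbf{T}$ is the unit circle in $\mathbb{C}$. A probability measure $\mu$ on $\mathbf{T}$ has finite logarithmic energy if $\iint\log|z-w|\,\mu(dz)\mu(dw)>-\infty$. For two probability measures with finite logarithmic energy, $\mathcal{H}(\mu,\nu)=-\iint\log|z-w|\,(\mu-\nu)(dz)(\mu-\nu)(dw)$. For a continuous $Q:\mathbf{T}\to\mathbb{R}$ (a potential) and a probability measure $\mu$ on $\mathbf{T}$, $E_Q(\mu)=\int Q\,d\mu-\iint\log|x-y|\,\mu(dx)\mu(dy)\in(-\infty,+\infty]$; $\mu_Q$ denotes the (unique) minimizer of $E_Q$ over probability measures on $\mathbf{T}$. Modified Wasserstein distance: let $\exp(x)=e^{ix}$ for $x\in\mathbb{R}$. For a measure $\mu$ on $\mathbf{T}$ let $\bar\mu$ be the measure on $\mathbb{R}$ given by $\bar\mu(A)=\sum_{n\in\mathbb{Z}}\mu(\exp(A\cap[2n\pi,2(n+1)\pi)))$, and let $\bar\mu_u$ be the restriction of $\bar\mu$ to $[u,u+2\pi)$. For probability measures $\mu,\nu$ on $\mathbf{T}$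 and $p\ge1$, $$\mathcal{W}_p(\mu,\nu)=\sup\Big\{W_p(\bar\mu_u,\bar\nu_v): u,v\in[0,2\pi],\ \int x\,\bar\mu_u(dx)=\int x\,\bar\nu_v(dx)\Big\},$$ where $W_p$ is the standard $p$-Wasserstein distance on $\mathbb{R}$ (cost $|x-y|^p$, with the power $1/p$), and the supremum over the empty set is $+\infty$. *)

theory Defs
  imports "HOL-Probability.Probability"
begin

abbreviation unit_circle :: "complex set" where
  "unit_circle \<equiv> sphere 0 1"

definition circle_probs :: "complex measure set" where
  "circle_probs = {\<mu>. prob_space \<mu> \<and> sets \<mu> = sets (restrict_space borel unit_circle)}"

text \<open>
  The logarithmic kernel with its true value on the diagonal. (The library has
  \<^term>\<open>ln (0::real) = 0\<close>, which would give atoms finite energy.)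
\<close>
definition log_dist :: "complex \<Rightarrow> complex \<Rightarrow> ereal" where
  "log_dist z w = (if z = w then -\<infinity> else ereal (ln (norm (z - w))))"

text \<open>
  Integral with values in the extended reals: integral of the positive part minus integral of
  the negative part. Meaningful if at least one of the two is finite; on the circle the positive
  part of the logarithmic kernel is bounded by \<^term>\<open>ln (2::real)\<close>.
\<close>
definition ereal_integral :: "'a measure \<Rightarrow> ('a \<Rightarrow> ereal) \<Rightarrow> ereal" where
  "ereal_integral M f =
     enn2ereal (\<integral>\<^sup>+ x. e2ennreal (f x) \<partial>M) - enn2ereal (\<integral>\<^sup>+ x. e2ennreal (- f x) \<partial>M)"

definition log_integral :: "complex measure \<Rightarrow> complex measure \<Rightarrow> ereal" where
  "log_integral \<mu> \<nu> = ereal_integral (\<mu> \<Otimes>\<^sub>M \<nu>) (\<lambda>(z, w). log_dist z w)"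

definition finite_log_energy :: "complex measure \<Rightarrow> bool" where
  "finite_log_energy \<mu> \<longleftrightarrow> log_integral \<mu> \<mu> > -\<infinity>"

text \<open>
  Minus the double integral of the kernel against the signed product measure
  $(\mu - \nu) \otimes (\mu - \nu)$, expanded by bilinearity.
\<close>
definition rel_log_energy :: "complex measure \<Rightarrow> complex measure \<Rightarrow> ereal" where
  "rel_log_energy \<mu> \<nu> =
     - (log_integral \<mu> \<mu> - log_integral \<mu> \<nu> - log_integral \<nu> \<mu> + log_integral \<nu> \<nu>)"

definition potential_energy :: "(complex \<Rightarrow> real) \<Rightarrow> complex measure \<Rightarrow> ereal" where
  "potential_energy Q \<mu> = ereal (\<integral>x. Q x \<partial>\<mu>) - log_integral \<mu> \<mu>"

definition equilibrium_measure :: "(complex \<Rightarrow> real) \<Rightarrow> complex measure \<Rightarrow> bool" where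
  "equilibrium_measure Q \<mu> \<longleftrightarrow> is_arg_min (potential_energy Q) (\<lambda>\<nu>. \<nu> \<in> circle_probs) \<mu>"

text \<open>
  The $2\pi$-periodic lift to the real line; the integral over the counting measure is the sum
  over all integers.
\<close>
definition circle_lift :: "complex measure \<Rightarrow> real measure" where
  "circle_lift \<mu> = measure_of UNIV (sets borel)
     (\<lambda>A. \<integral>\<^sup>+ n. emeasure \<mu> (cis ` (A \<inter> {2 * of_int n * pi ..< 2 * (of_int n + 1) * pi}))
             \<partial>count_space (UNIV :: int set))"

text \<open>
  Restriction of the lift to one period, kept as a Borel measure on the whole line so that
  restrictions to different periods can be coupled.
\<close>
definition circle_lift_from :: "complex measure \<Rightarrow> real \<Rightarrow> real measure" where
  "circle_lift_from \<mu> u = density (circle_lift \<mu>) (indicator {u ..< u + 2 * pi})"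

definition couplings :: "real measure \<Rightarrow> real measure \<Rightarrow> (real \<times> real) measure set" where
  "couplings M N = {P. sets P = sets (borel \<Otimes>\<^sub>M borel) \<and> distr P borel fst = M \<and> distr P borel snd = N}"

definition wasserstein :: "real \<Rightarrow> real measure \<Rightarrow> real measure \<Rightarrow> ennreal" where
  "wasserstein p M N =
     (let c = (INF P \<in> couplings M N. \<integral>\<^sup>+ (x, y). ennreal (\<bar>x - y\<bar> powr p) \<partial>P)
      in if c = \<top> then \<top> else ennreal (enn2real c powr (1 / p)))"

text \<open>
  The supremum over the empty set is by convention infinite here, whereas
  \<^term>\<open>Sup {} = (0::ennreal)\<close>.
\<close>
definition circle_wasserstein :: "real \<Rightarrow> complex measure \<Rightarrow> complex measure \<Rightarrow> ennreal" where
  "circle_wasserstein p \<mu> \<nu> =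
     (let S = {wasserstein p (circle_lift_from \<mu> u) (circle_lift_from \<nu> v) | u v.
                 u \<in> {0..2 * pi} \<and> v \<in> {0..2 * pi} \<and>
                 (\<integral>x. x \<partial>circle_lift_from \<mu> u) = (\<integral>x. x \<partial>circle_lift_from \<nu> v)}
      in if S = {} then \<top> else Sup S)"

end

(*
  Let F and G be the angular distribution functions of mu and nu, and let h be the primitive
  F - G + const of mu - nu with mean zero on the circle. If the lifts starting at u and v have
  equal means, the difference of their distribution functions is, modulo 2 pi, a decomposition of
  h into terms of one sign, so by the quantile coupling their W_1 distance is at most the L^1 norm
  of h, whatever u and v are. With c_k the Fourier coefficients of mu - nu,
    pi |h|_2^2 = sum_k |c_k|^2 / k^2  <=  sum_k |c_k|^2 / k = H(mu, nu),
  and Cauchy-Schwarz gives W_1^2 <= 2 pi |h|_2^2 <= 2 H. As a measure of finite energy has no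
  atoms, h is continuous, so equality in Cauchy-Schwarz makes h constant, that is, mu = nu. Both
  series are Abel summed: h is a bounded limit of the smoothed primitives, and
  |z - w| <= 2 |1 - r z cnj w| dominates the smoothed kernels; positivity of the Abel sums also
  shows that the mutual energy is finite. For the statement on potentials, E_Q along the segment
  from mu_Q to mu is the polynomial E_Q(mu_Q) + s L + s^2 H with L >= 0 by minimality, so
  H <= E_Q(mu) - E_Q(mu_Q).
*)
theory Submission
  imports Defs "HOL-Complex_Analysis.Cauchy_Integral_Theorem"
begin

section \<open>The lift of a circle measure\<close>

text \<open>The constant in h is dictated by the lifts: moving the angles below u up by one turn
  raises the mean by 2 pi F(u), so equal means say that G(v) - F(u) is the difference of the mean
  angles divided by 2 pi, which is exactly what makes F - G mean zero. This is why u and v drop out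
  of the bound. That such u and v exist must be proved as well, since the supremum over the empty
  set is infinite. Energy and primitive meet in the series -Ln (1 - x) = sum x^k / k: its real part
  at x = r z cnj w is the smoothed energy kernel, its imaginary part at x = r cis t cnj z integrates
  to the smoothed primitive and becomes a sawtooth as r tends to 1. The kernel is unbounded below
  and energies may be infinite, so finiteness is decided on the nonnegative gap ln 2 - log |z - w|,
  set to \<open>\<top>\<close> on the diagonal, where Tonelli and Fatou apply without integrability.
  For potentials, the minimizer has finite energy because the uniform measure is a competitor of
  finite energy, and a \<open>\<mu>\<close> of infinite energy makes the right side
  infinite.\<close>

lemma measurable_Arg2pi [measurable]: "Arg2pi \<in> borel_measurable borel"
  by (rule borel_measurable_iff_le[THEN iffD2]) (auto intro: closed_Arg2pi2pi_le borel_closed)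

lemma cis_Arg2pi: "norm z = 1 \<Longrightarrow> cis (Arg2pi z) = z"
  by (simp add: cis_conv_exp complex_norm_eq_1_exp[symmetric])

lemma Arg2pi_cis: "0 \<le> x \<Longrightarrow> x < 2 * pi \<Longrightarrow> Arg2pi (cis x) = x"
  by (simp add: cis_conv_exp Arg2pi_exp)

lemma Arg2pi_bounds: "0 \<le> Arg2pi z" "Arg2pi z < 2 * pi"
  using Arg2pi by auto

locale circle_prob = prob_space \<mu> for \<mu> :: "complex measure" +
  assumes sets_circle: "sets \<mu> = sets (restrict_space borel unit_circle)"
begin

lemma space_circle: "space \<mu> = unit_circle"
  using sets_eq_imp_space_eq[OF sets_circle] by (simp add: space_restrict_space)

lemma norm_circle: "z \<in> space \<mu> \<Longrightarrow> norm z = 1"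
  by (simp add: space_circle)

lemma measurable_circle [measurable (raw)]: "(\<lambda>z. z) \<in> \<mu> \<rightarrow>\<^sub>M borel"
  by (subst measurable_cong_sets[OF sets_circle refl]) (auto intro: measurable_restrict_space1)

lemma measurable_circleI: "f \<in> borel \<rightarrow>\<^sub>M N \<Longrightarrow> f \<in> \<mu> \<rightarrow>\<^sub>M N"
  using measurable_compose[OF measurable_circle] by simp

text \<open>On one period \<open>cis\<close> is inverted by a translate of \<open>Arg2pi\<close>.
  Each summand of the lift thus turns from the measure of an image into that of a preimage, where
  measurability and additivity are immediate.\<close>

lemma cis_image_period:
  "cis ` (A \<inter> {2 * of_int n * pi ..< 2 * (of_int n + 1) * pi})
     = {z \<in> space \<mu>. Arg2pi z + 2 * pi * of_int n \<in> A}"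
proof safe
  fix x assume x: "x \<in> A" "x \<in> {2 * real_of_int n * pi ..< 2 * (real_of_int n + 1) * pi}"
  have "cis x = cis (x - 2 * pi * of_int n)"
    by (metis cis_divide cis_multiple_2pi Ints_of_int div_by_1)
  then have "Arg2pi (cis x) = x - 2 * pi * of_int n"
    using x Arg2pi_cis[of "x - 2 * pi * of_int n"] by (simp add: algebra_simps)
  then show "Arg2pi (cis x) + 2 * pi * real_of_int n \<in> A" using x by simp
next
  fix z assume z: "z \<in> space \<mu>" "Arg2pi z + 2 * pi * of_int n \<in> A"
  show "z \<in> cis ` (A \<inter> {2 * of_int n * pi ..< 2 * (of_int n + 1) * pi})"
  proof
    show "z = cis (Arg2pi z + 2 * pi * of_int n)"
      by (metis z(1) norm_circle cis_Arg2pi cis_mult cis_multiple_2pi Ints_of_int mult.right_neutral)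
    show "Arg2pi z + 2 * pi * of_int n \<in> A \<inter> {2 * of_int n * pi ..< 2 * (of_int n + 1) * pi}"
      using z Arg2pi_bounds[of z] by (auto simp: algebra_simps)
  qed
qed (auto simp: space_circle)

text \<open>\<open>measure_of\<close> returns the given set function only if that function is
  countably additive. Here summand n is the law of \<open>Arg2pi\<close> shifted by n turns, and
  additivity passes through the sum over n.\<close>

lemma emeasure_circle_lift:
  assumes [measurable]: "A \<in> sets borel"
  shows "emeasure (circle_lift \<mu>) A
    = (\<integral>\<^sup>+ n. emeasure \<mu> {z \<in> space \<mu>. Arg2pi z + 2 * pi * of_int n \<in> A} \<partial>count_space (UNIV :: int set))"
proof -
  define L :: "real set \<Rightarrow> ennreal" where "L = (\<lambda>A. \<integral>\<^sup>+ n. emeasure \<mu> (cis ` (A \<inter> {2 * of_int n * pi ..< 2 * (of_int n + 1) * pi}))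
             \<partial>count_space (UNIV :: int set))"
  have L: "L A = (\<integral>\<^sup>+ n. emeasure (distr \<mu> borel (\<lambda>z. Arg2pi z + 2 * pi * of_int n)) A \<partial>count_space (UNIV :: int set))"
    if [measurable]: "A \<in> sets borel" for A
    unfolding L_def cis_image_period
    by (intro nn_integral_cong) (auto simp: emeasure_distr intro!: arg_cong[where f="emeasure \<mu>"])
  have "countably_additive (sets borel) L"
  proof (rule countably_additiveI)
    fix B :: "nat \<Rightarrow> real set" assume B: "range B \<subseteq> sets borel" "disjoint_family B" "(\<Union>i. B i) \<in> sets borel"
    then have B': "B i \<in> sets borel" for i by auto
    show "(\<Sum>i. L (B i)) = L (\<Union>i. B i)"
      using B by (simp add: L[OF B'] L[OF B(3)] nn_integral_suminf[symmetric] suminf_emeasure)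
  qed
  moreover have "positive (sets borel) L" by (simp add: positive_def L_def)
  ultimately have "emeasure (circle_lift \<mu>) A = L A"
    unfolding circle_lift_def L_def[symmetric]
    by (intro emeasure_measure_of_sigma) (use assms sets.sigma_algebra_axioms[of "borel :: real measure"] in auto)
  then show ?thesis by (simp only: L_def cis_image_period)
qed

lemma sets_circle_lift [simp, measurable_cong]: "sets (circle_lift \<mu>) = sets borel"
  using sets.sigma_sets_eq[of "borel :: real measure"] by (simp add: circle_lift_def)

text \<open>A window of length 2 pi starting in [0, 2 pi] meets only the copies 0 and 1 of the
  circle; angles before the cut \<open>u\<close> are read off from copy 1.\<close>

lemma circle_lift_from_eq:
  assumes u: "u \<in> {0..2*pi}"
  shows "circle_lift_from \<mu> u = distr \<mu> borel (\<lambda>z. if Arg2pi z < u then Arg2pi z + 2 * pi else Arg2pi z)"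
    (is "_ = distr \<mu> borel ?X")
proof (rule measure_eqI)
  show "sets (circle_lift_from \<mu> u) = sets (distr \<mu> borel ?X)"
    by (simp add: circle_lift_from_def)
  fix A assume "A \<in> sets (circle_lift_from \<mu> u)"
  then have A[measurable]: "A \<in> sets borel" by (simp add: circle_lift_from_def)
  let ?I = "{u ..< u + 2 * pi}"
  let ?E = "\<lambda>n::int. {z \<in> space \<mu>. Arg2pi z + 2 * pi * of_int n \<in> A \<inter> ?I}"
  \<comment> \<open>The window lies in [0, 4 pi) and \<open>Arg2pi\<close> in [0, 2 pi), which
    forces -1 < n < 2.\<close>
  have emp: "?E n = {}" if "n \<notin> {0,1}" for n
  proof -
    have False if "Arg2pi z + 2 * pi * of_int n \<in> ?I" for z
    proof -
      have "Arg2pi z + 2 * pi * of_int n < 4 * pi" "Arg2pi z + 2 * pi * of_int n \<ge> 0" using that u by auto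
      then have "2 * pi * of_int n < 2 * pi * (2::real)" "2 * pi * of_int n > 2 * pi * (-1::real)"
        using Arg2pi_bounds[of z] by linarith+
      then have "of_int n < (2::real)" "of_int n > (-1::real)"
        by - (subst (asm) mult_less_cancel_left_pos, simp, assumption)+
      then show False using \<open>n \<notin> {0,1}\<close> by auto
    qed
    then show ?thesis by blast
  qed
  have "emeasure (circle_lift_from \<mu> u) A = emeasure (circle_lift \<mu>) (A \<inter> ?I)"
    unfolding circle_lift_from_def
    by (subst emeasure_density) (auto simp: indicator_inter_arith[symmetric] nn_integral_indicator Int_commute)
  also have "\<dots> = (\<integral>\<^sup>+ n. emeasure \<mu> (?E n) \<partial>count_space UNIV)"
    by (rule emeasure_circle_lift) measurable
  also have "\<dots> = (\<Sum>n\<in>{0,1}. emeasure \<mu> (?E n))"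
  proof (rule nn_integral_count_space')
    show "emeasure \<mu> (?E n) = 0" if "n \<notin> {0,1}" for n
      unfolding emp[OF that] by simp
  qed auto
  also have "\<dots> = emeasure \<mu> (?E 0) + emeasure \<mu> (?E 1)" by simp
  also have "\<dots> = emeasure \<mu> (?E 0 \<union> ?E 1)"
  proof (rule plus_emeasure)
    show "?E 0 \<in> sets \<mu>" "?E 1 \<in> sets \<mu>" by measurable
    show "?E 0 \<inter> ?E 1 = {}" by auto
  qed
  also have "?E 0 \<union> ?E 1 = ?X -` A \<inter> space \<mu>"
  proof (rule set_eqI)
    show "z \<in> ?E 0 \<union> ?E 1 \<longleftrightarrow> z \<in> ?X -` A \<inter> space \<mu>" for z
      using u Arg2pi_bounds[of z] by (cases "Arg2pi z < u") auto
  qed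
  also have "emeasure \<mu> \<dots> = emeasure (distr \<mu> borel ?X) A"
    by (simp add: emeasure_distr)
  finally show "emeasure (circle_lift_from \<mu> u) A = emeasure (distr \<mu> borel ?X) A" .
qed

end

section \<open>The quantile coupling\<close>

text \<open>The levels that separate the two numbers form a half-open interval between them; this
  turns a transport cost into an integral over levels.\<close>

lemma nn_integral_indicator_between:
  fixes a b :: real
  shows "ennreal \<bar>a - b\<bar> = (\<integral>\<^sup>+ t. indicator {t. (a \<le> t) \<noteq> (b \<le> t)} t \<partial>lborel)"
proof -
  have *: "{t. (a \<le> t) \<noteq> (b \<le> t)} = {min a b ..< max a b}" by (auto simp: min_def max_def)
  have "(\<integral>\<^sup>+ t. indicator {t. (a \<le> t) \<noteq> (b \<le> t)} t \<partial>lborel) = emeasure lborel {min a b ..< max a b}"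
    unfolding * by (rule nn_integral_indicator) simp
  then show ?thesis by (simp add: min_def max_def abs_if)
qed

lemma emeasure_between_01:
  fixes a b :: real
  assumes "0 \<le> a" "a \<le> 1" "0 \<le> b" "b \<le> 1"
  shows "emeasure lborel ({\<omega>. (\<omega> \<le> a) \<noteq> (\<omega> \<le> b)} \<inter> {0<..<1}) \<le> ennreal \<bar>a - b\<bar>"
proof -
  have "{\<omega>. (\<omega> \<le> a) \<noteq> (\<omega> \<le> b)} \<inter> {0<..<1} \<subseteq> {min a b <.. max a b}" by (auto simp: min_def max_def)
  then have "emeasure lborel ({\<omega>. (\<omega> \<le> a) \<noteq> (\<omega> \<le> b)} \<inter> {0<..<1}) \<le> emeasure lborel {min a b <.. max a b}"
    by (intro emeasure_mono) auto
  then show ?thesis by (simp add: min_def max_def abs_if split: if_splits)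
qed

text \<open>The cost of the quantile coupling, by the layer-cake formula for \<^term>\<open>\<bar>x - y\<bar>\<close>.\<close>

lemma wasserstein_1_le_cdf:
  assumes "real_distribution M" "real_distribution N"
  shows "wasserstein 1 M N \<le> (\<integral>\<^sup>+ t. ennreal \<bar>cdf M t - cdf N t\<bar> \<partial>lborel)"
proof -
  interpret M: cdf_distribution M by (simp add: cdf_distribution_def assms)
  interpret N: cdf_distribution N by (simp add: cdf_distribution_def assms)
  let ?\<Omega> = "restrict_space lborel {0<..<1::real} :: real measure"
  have mI [measurable]: "M.I \<in> ?\<Omega> \<rightarrow>\<^sub>M borel" "N.I \<in> ?\<Omega> \<rightarrow>\<^sub>M borel"
    using M.measurable_CI N.measurable_CI by (simp_all cong: measurable_cong_sets sets_restrict_space_cong)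
  \<comment> \<open>\<open>M.I\<close> and \<open>N.I\<close> are the quantile functions; evaluating
    both at the same uniform variable on (0, 1) gives the monotone coupling.\<close>
  let ?P = "distr ?\<Omega> (borel \<Otimes>\<^sub>M borel) (\<lambda>\<omega>. (M.I \<omega>, N.I \<omega>))"
  have P: "?P \<in> couplings M N"
    using M.distr_I_eq_M N.distr_I_eq_M
    by (simp add: couplings_def distr_distr comp_def)
  interpret \<Omega>: sigma_finite_measure ?\<Omega>
    by (intro sigma_finite_measure_restrict_space) (auto intro: lborel.sigma_finite_measure_axioms)
  interpret PS: pair_sigma_finite ?\<Omega> lborel ..
  let ?E = "\<lambda>\<omega> t. (M.I \<omega> \<le> t) \<noteq> (N.I \<omega> \<le> t)"
  have "(\<integral>\<^sup>+ (x, y). ennreal (\<bar>x - y\<bar> powr 1) \<partial>?P) = (\<integral>\<^sup>+ \<omega>. ennreal \<bar>M.I \<omega> - N.I \<omega>\<bar> \<partial>?\<Omega>)"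
    by (subst nn_integral_distr) (auto simp: split_def)
  also have "\<dots> = (\<integral>\<^sup>+ \<omega>. (\<integral>\<^sup>+ t. indicator {p. ?E (fst p) (snd p)} (\<omega>, t) \<partial>lborel) \<partial>?\<Omega>)"
    unfolding nn_integral_indicator_between
    by (intro nn_integral_cong) (simp add: indicator_def)
  also have "\<dots> = (\<integral>\<^sup>+ t. (\<integral>\<^sup>+ \<omega>. indicator {p. ?E (fst p) (snd p)} (\<omega>, t) \<partial>?\<Omega>) \<partial>lborel)"
  proof (rule PS.Fubini'[symmetric])
    have "{p \<in> space (?\<Omega> \<Otimes>\<^sub>M lborel). ?E (fst p) (snd p)} \<in> sets (?\<Omega> \<Otimes>\<^sub>M lborel)"
      by measurable
    then have "indicator {p \<in> space (?\<Omega> \<Otimes>\<^sub>M lborel). ?E (fst p) (snd p)} \<in> borel_measurable (?\<Omega> \<Otimes>\<^sub>M lborel)"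
      by (rule borel_measurable_indicator)
    then show "(\<lambda>(x, y). indicator {p. ?E (fst p) (snd p)} (x, y)) \<in> borel_measurable (?\<Omega> \<Otimes>\<^sub>M lborel)"
      by (rule measurable_cong[THEN iffD1, rotated]) (auto simp: indicator_def)
  qed
  also have "\<dots> \<le> (\<integral>\<^sup>+ t. ennreal \<bar>cdf M t - cdf N t\<bar> \<partial>lborel)"
  proof (rule nn_integral_mono)
    fix t :: real
    have "(\<integral>\<^sup>+ \<omega>. indicator {p. ?E (fst p) (snd p)} (\<omega>, t) \<partial>?\<Omega>)
      = (\<integral>\<^sup>+ \<omega>. indicator ({\<omega>. (\<omega> \<le> cdf M t) \<noteq> (\<omega> \<le> cdf N t)} \<inter> {0<..<1}) \<omega> \<partial>lborel)"
    proof (subst nn_integral_restrict_space)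
      show "(\<integral>\<^sup>+ \<omega>. indicator {p. ?E (fst p) (snd p)} (\<omega>, t) * indicator {0<..<1} \<omega> \<partial>lborel)
        = (\<integral>\<^sup>+ \<omega>. indicator ({\<omega>. (\<omega> \<le> cdf M t) \<noteq> (\<omega> \<le> cdf N t)} \<inter> {0<..<1}) \<omega> \<partial>lborel)"
        \<comment> \<open>Quantile and distribution function form a Galois connection:
          \<open>M.I \<omega> \<le> t\<close> holds iff \<open>\<omega> \<le> cdf M t\<close>. So
          the level \<open>t\<close> separates the quantiles exactly when \<open>\<omega>\<close>
          lies between the two cdf values.\<close>
        by (rule nn_integral_cong)
          (use M.pseudoinverse[of _ t] N.pseudoinverse[of _ t] in \<open>auto simp: indicator_def\<close>)
    qed simp
    also have "\<dots> = emeasure lborel ({\<omega>. (\<omega> \<le> cdf M t) \<noteq> (\<omega> \<le> cdf N t)} \<inter> {0<..<1})"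
      by (rule nn_integral_indicator) measurable
    also have "\<dots> \<le> ennreal \<bar>cdf M t - cdf N t\<bar>"
      by (rule emeasure_between_01) (auto simp: M.cdf_nonneg N.cdf_nonneg M.cdf_bounded_prob N.cdf_bounded_prob)
    finally show "(\<integral>\<^sup>+ \<omega>. indicator {p. ?E (fst p) (snd p)} (\<omega>, t) \<partial>?\<Omega>) \<le> ennreal \<bar>cdf M t - cdf N t\<bar>" .
  qed
  finally have "(INF P\<in>couplings M N. \<integral>\<^sup>+ (x, y). ennreal (\<bar>x - y\<bar> powr 1) \<partial>P)
      \<le> (\<integral>\<^sup>+ t. ennreal \<bar>cdf M t - cdf N t\<bar> \<partial>lborel)"
    by (rule INF_lower2[OF P])
  \<comment> \<open>For exponent 1 the outer power is the identity on finite costs, and the infinite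
    cost is returned unchanged.\<close>
  moreover have "(let c = c0 in if c = \<top> then \<top> else ennreal (enn2real c powr (1 / 1))) = c0" for c0
    by (simp add: Let_def less_top)
  ultimately show ?thesis
    by (simp only: wasserstein_def)
qed

section \<open>The modified Wasserstein distance\<close>

definition angle_cdf :: "complex measure \<Rightarrow> real \<Rightarrow> real" where
  "angle_cdf \<mu> t = measure \<mu> {z \<in> space \<mu>. Arg2pi z \<le> t}"

definition mean_angle :: "complex measure \<Rightarrow> real" where
  "mean_angle \<mu> = (\<integral>z. Arg2pi z \<partial>\<mu>)"

text \<open>Without atoms the angular distribution function is continuous, so strict and weak
  inequalities at a cut point give the same mass.\<close>

locale atomless_circle_prob = circle_prob +
  assumes atomless: "norm z = 1 \<Longrightarrow> measure \<mu> {z} = 0"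

context circle_prob
begin

lemma Arg2pi_measurable [measurable]: "Arg2pi \<in> borel_measurable \<mu>"
  by (rule measurable_circleI) measurable

lemma integrable_Arg2pi: "integrable \<mu> Arg2pi"
  by (rule integrable_const_bound[where B="2*pi"]) (use Arg2pi_bounds in \<open>auto intro: less_imp_le simp: abs_of_nonneg\<close>)

lemma mean_angle_bounds: "0 \<le> mean_angle \<mu>" "mean_angle \<mu> \<le> 2 * pi"
proof -
  show "0 \<le> mean_angle \<mu>" unfolding mean_angle_def using Arg2pi_bounds by simp
  have "mean_angle \<mu> \<le> (\<integral>z. 2 * pi \<partial>\<mu>)" unfolding mean_angle_def
    by (rule integral_mono[OF integrable_Arg2pi]) (use Arg2pi_bounds in \<open>auto intro: less_imp_le\<close>)
  then show "mean_angle \<mu> \<le> 2 * pi" by (simp add: prob_space)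
qed

lemma angle_cdf_eq_cdf: "angle_cdf \<mu> = cdf (distr \<mu> borel Arg2pi)"
  by (rule ext) (auto simp: angle_cdf_def cdf_def measure_distr intro!: arg_cong[where f="measure \<mu>"])

lemma angle_cdf_mono: "s \<le> t \<Longrightarrow> angle_cdf \<mu> s \<le> angle_cdf \<mu> t"
  unfolding angle_cdf_def by (intro finite_measure_mono) auto

lemma angle_cdf_bounds: "0 \<le> angle_cdf \<mu> t" "angle_cdf \<mu> t \<le> 1"
  by (auto simp: angle_cdf_def)

lemma angle_cdf_2pi: "2 * pi \<le> t \<Longrightarrow> angle_cdf \<mu> t = 1"
proof -
  assume "2 * pi \<le> t"
  then have "{z \<in> space \<mu>. Arg2pi z \<le> t} = space \<mu>" using Arg2pi_bounds(2) by (auto intro: order.trans less_imp_le)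
  then show ?thesis by (simp add: angle_cdf_def prob_space)
qed

lemma measurable_shift [measurable]:
  "(\<lambda>z. if Arg2pi z < u then Arg2pi z + 2 * pi else Arg2pi z) \<in> borel_measurable \<mu>"
  by measurable

lemma real_distribution_lift_from:
  assumes "u \<in> {0..2*pi}"
  shows "real_distribution (circle_lift_from \<mu> u)"
  unfolding circle_lift_from_eq[OF assms] by (rule real_distribution_distr) measurable

lemma cdf_lift_from:
  assumes "u \<in> {0..2*pi}"
  shows "cdf (circle_lift_from \<mu> u) t
    = measure \<mu> {z \<in> space \<mu>. (if Arg2pi z < u then Arg2pi z + 2 * pi else Arg2pi z) \<le> t}"
  unfolding circle_lift_from_eq[OF assms]
  by (auto simp: cdf_def measure_distr intro!: arg_cong[where f="measure \<mu>"])

end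

context atomless_circle_prob
begin

lemma measure_Arg2pi_eq: "measure \<mu> {z \<in> space \<mu>. Arg2pi z = t} = 0"
proof -
  have "measure \<mu> {z \<in> space \<mu>. Arg2pi z = t} \<le> measure \<mu> ({cis t} \<inter> space \<mu>)"
  proof (rule finite_measure_mono)
    show "{z \<in> space \<mu>. Arg2pi z = t} \<subseteq> {cis t} \<inter> space \<mu>"
      using cis_Arg2pi norm_circle by force
    have "{z \<in> space \<mu>. z = cis t} \<in> sets \<mu>" by measurable
    also have "{z \<in> space \<mu>. z = cis t} = {cis t} \<inter> space \<mu>" by auto
    finally show "{cis t} \<inter> space \<mu> \<in> sets \<mu>" .
  qed
  also have "{cis t} \<inter> space \<mu> = {cis t}" by (auto simp: space_circle)
  finally show ?thesis using atomless[of "cis t"] by (simp add: measure_le_0_iff)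
qed

lemma angle_cdf_less: "measure \<mu> {z \<in> space \<mu>. Arg2pi z < t} = angle_cdf \<mu> t"
proof -
  have "angle_cdf \<mu> t = measure \<mu> ({z \<in> space \<mu>. Arg2pi z < t} \<union> {z \<in> space \<mu>. Arg2pi z = t})"
    unfolding angle_cdf_def by (rule arg_cong[where f="measure \<mu>"]) auto
  also have "\<dots> = measure \<mu> {z \<in> space \<mu>. Arg2pi z < t} + measure \<mu> {z \<in> space \<mu>. Arg2pi z = t}"
    by (rule finite_measure_Union) auto
  finally show ?thesis by (simp add: measure_Arg2pi_eq)
qed

lemma angle_cdf_0: "angle_cdf \<mu> 0 = 0"
  using measure_Arg2pi_eq[of 0] Arg2pi_bounds(1) by (simp add: angle_cdf_def antisym_conv)

lemma continuous_angle_cdf: "continuous_on S (angle_cdf \<mu>)"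
proof -
  interpret R: real_distribution "distr \<mu> borel Arg2pi"
    by (rule real_distribution_distr) measurable
  have "measure (distr \<mu> borel Arg2pi) {x} = measure \<mu> {z \<in> space \<mu>. Arg2pi z = x}" for x
    by (auto simp: measure_distr intro!: arg_cong[where f="measure \<mu>"])
  then show ?thesis
    unfolding angle_cdf_eq_cdf
    by (intro continuous_at_imp_continuous_on ballI) (simp add: R.isCont_cdf measure_Arg2pi_eq)
qed

lemma angle_cdf_borel [measurable]: "angle_cdf \<mu> \<in> borel_measurable borel"
  by (rule borel_measurable_continuous_onI[OF continuous_angle_cdf])

lemma prob_Arg2pi_between:
  "s \<le> t \<Longrightarrow> measure \<mu> {z \<in> space \<mu>. s \<le> Arg2pi z \<and> Arg2pi z \<le> t} = angle_cdf \<mu> t - angle_cdf \<mu> s"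
proof -
  assume "s \<le> t"
  have "angle_cdf \<mu> t = measure \<mu> ({z \<in> space \<mu>. Arg2pi z < s} \<union> {z \<in> space \<mu>. s \<le> Arg2pi z \<and> Arg2pi z \<le> t})"
    unfolding angle_cdf_def by (rule arg_cong[where f="measure \<mu>"]) (use \<open>s \<le> t\<close> in auto)
  also have "\<dots> = measure \<mu> {z \<in> space \<mu>. Arg2pi z < s} + measure \<mu> {z \<in> space \<mu>. s \<le> Arg2pi z \<and> Arg2pi z \<le> t}"
    by (rule finite_measure_Union) auto
  finally show ?thesis by (simp add: angle_cdf_less)
qed

text \<open>In the first turn the mass collected consists of the angles in [u, t]; in the second
  turn only those in (t, u) are still missing. Written with \<open>max\<close> and
  \<open>min\<close>, the two turns carry the positive and the negative part of the single number
  F(t) - F(u).\<close>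

lemma cdf_lift_from_cases:
  assumes u: "u \<in> {0..2*pi}"
  shows "t < 0 \<Longrightarrow> cdf (circle_lift_from \<mu> u) t = 0"
    and "4 * pi \<le> t \<Longrightarrow> cdf (circle_lift_from \<mu> u) t = 1"
    and "0 \<le> t \<Longrightarrow> t < 2 * pi \<Longrightarrow> cdf (circle_lift_from \<mu> u) t = max 0 (angle_cdf \<mu> t - angle_cdf \<mu> u)"
    and "0 \<le> t \<Longrightarrow> t < 2 * pi \<Longrightarrow> cdf (circle_lift_from \<mu> u) (2 * pi + t) = 1 + min 0 (angle_cdf \<mu> t - angle_cdf \<mu> u)"
proof -
  let ?X = "\<lambda>z. if Arg2pi z < u then Arg2pi z + 2 * pi else Arg2pi z"
  {
    assume "t < 0"
    then have "{z \<in> space \<mu>. ?X z \<le> t} = {}"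
      using Arg2pi_bounds(1) by (auto split: if_splits) (metis add_nonneg_nonneg not_le order.strict_trans1 pi_ge_zero mult_nonneg_nonneg zero_le_numeral, metis not_le order.strict_trans1)
    then show "cdf (circle_lift_from \<mu> u) t = 0" by (simp only: cdf_lift_from[OF u] measure_empty)
  next
    assume "4 * pi \<le> t"
    have "?X z \<le> t" for z
      using Arg2pi_bounds[of z] \<open>4 * pi \<le> t\<close> by auto
    then show "cdf (circle_lift_from \<mu> u) t = 1" by (simp add: cdf_lift_from[OF u] prob_space)
  next
    assume t: "0 \<le> t" "t < 2 * pi"
    have "{z \<in> space \<mu>. ?X z \<le> t} = {z \<in> space \<mu>. u \<le> Arg2pi z \<and> Arg2pi z \<le> t}"
    proof (intro Collect_cong conj_cong refl)
      show "?X z \<le> t \<longleftrightarrow> u \<le> Arg2pi z \<and> Arg2pi z \<le> t" for z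
        using t Arg2pi_bounds[of z] by auto
    qed
    moreover have "measure \<mu> {z \<in> space \<mu>. u \<le> Arg2pi z \<and> Arg2pi z \<le> t} = max 0 (angle_cdf \<mu> t - angle_cdf \<mu> u)"
    proof (cases "u \<le> t")
      case True
      then show ?thesis using angle_cdf_mono[of u t] by (simp add: prob_Arg2pi_between)
    next
      case False
      then have "{z \<in> space \<mu>. u \<le> Arg2pi z \<and> Arg2pi z \<le> t} = {}" by auto
      then show ?thesis using False angle_cdf_mono[of t u] by (simp only: measure_empty) simp
    qed
    ultimately show "cdf (circle_lift_from \<mu> u) t = max 0 (angle_cdf \<mu> t - angle_cdf \<mu> u)"
      by (simp only: cdf_lift_from[OF u])
    have "{z \<in> space \<mu>. ?X z \<le> 2 * pi + t} = space \<mu> - {z \<in> space \<mu>. t < Arg2pi z \<and> Arg2pi z < u}"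
    proof (rule set_eqI)
      show "z \<in> {z \<in> space \<mu>. ?X z \<le> 2 * pi + t} \<longleftrightarrow> z \<in> space \<mu> - {z \<in> space \<mu>. t < Arg2pi z \<and> Arg2pi z < u}" for z
        using t Arg2pi_bounds[of z] by auto
    qed
    moreover have "measure \<mu> (space \<mu> - {z \<in> space \<mu>. t < Arg2pi z \<and> Arg2pi z < u})
      = 1 - measure \<mu> {z \<in> space \<mu>. t < Arg2pi z \<and> Arg2pi z < u}"
      by (rule prob_compl) measurable
    moreover have "measure \<mu> {z \<in> space \<mu>. t < Arg2pi z \<and> Arg2pi z < u} = - min 0 (angle_cdf \<mu> t - angle_cdf \<mu> u)"
    proof (cases "t \<le> u")
      case True
      have "angle_cdf \<mu> u = measure \<mu> ({z \<in> space \<mu>. Arg2pi z \<le> t} \<union> {z \<in> space \<mu>. t < Arg2pi z \<and> Arg2pi z < u} \<union> {z \<in> space \<mu>. Arg2pi z = u})"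
        unfolding angle_cdf_def by (rule arg_cong[where f="measure \<mu>"]) (use True in auto)
      also have "\<dots> = measure \<mu> ({z \<in> space \<mu>. Arg2pi z \<le> t} \<union> {z \<in> space \<mu>. t < Arg2pi z \<and> Arg2pi z < u})"
        by (rule measure_Un_null_set) (auto simp: null_sets_def emeasure_eq_measure measure_Arg2pi_eq)
      also have "\<dots> = angle_cdf \<mu> t + measure \<mu> {z \<in> space \<mu>. t < Arg2pi z \<and> Arg2pi z < u}"
        unfolding angle_cdf_def by (rule finite_measure_Union) auto
      finally show ?thesis using True angle_cdf_mono[of t u] by simp
    next
      case False
      then have "{z \<in> space \<mu>. t < Arg2pi z \<and> Arg2pi z < u} = {}" by auto
      then show ?thesis using False angle_cdf_mono[of u t] by (simp only: measure_empty) simp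
    qed
    ultimately show "cdf (circle_lift_from \<mu> u) (2 * pi + t) = 1 + min 0 (angle_cdf \<mu> t - angle_cdf \<mu> u)"
      by (simp only: cdf_lift_from[OF u])
  }
qed

text \<open>Exactly the mass of the angles below \<open>u\<close> is moved, and it is moved by one
  full turn.\<close>

lemma integral_lift_from:
  assumes u: "u \<in> {0..2*pi}"
  shows "(\<integral>x. x \<partial>circle_lift_from \<mu> u) = mean_angle \<mu> + 2 * pi * angle_cdf \<mu> u"
proof -
  have "(\<integral>x. x \<partial>circle_lift_from \<mu> u) = (\<integral>z. Arg2pi z + 2 * pi * indicator {z \<in> space \<mu>. Arg2pi z < u} z \<partial>\<mu>)"
    unfolding circle_lift_from_eq[OF u]
    by (subst integral_distr) (auto intro!: Bochner_Integration.integral_cong simp: indicator_def)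
  also have "\<dots> = mean_angle \<mu> + 2 * pi * measure \<mu> {z \<in> space \<mu>. Arg2pi z < u}"
    by (subst Bochner_Integration.integral_add[OF integrable_Arg2pi])
      (auto simp: mean_angle_def less_top[symmetric] intro!: integrable_real_indicator)
  finally show ?thesis by (simp add: angle_cdf_less)
qed

end

text \<open>The two turns of the lifts are folded onto [0, 2 pi] and their cdf differences are added
  at equal angles. The bound does not depend on the cuts because equal means determine G(v) -
  F(u).\<close>

lemma wasserstein_lift_from_le:
  assumes "atomless_circle_prob \<mu>" "atomless_circle_prob \<nu>" and uv: "u \<in> {0..2*pi}" "v \<in> {0..2*pi}"
  and mean: "(\<integral>x. x \<partial>circle_lift_from \<mu> u) = (\<integral>x. x \<partial>circle_lift_from \<nu> v)"
  shows "wasserstein 1 (circle_lift_from \<mu> u) (circle_lift_from \<nu> v)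
    \<le> (\<integral>\<^sup>+ t. ennreal \<bar>angle_cdf \<mu> t - angle_cdf \<nu> t + (mean_angle \<mu> - mean_angle \<nu>) / (2 * pi)\<bar> * indicator {0..2*pi} t \<partial>lborel)"
proof -
  interpret M: atomless_circle_prob \<mu> by fact
  interpret N: atomless_circle_prob \<nu> by fact
  interpret Mu: real_distribution "circle_lift_from \<mu> u" using uv by (intro M.real_distribution_lift_from)
  interpret Nv: real_distribution "circle_lift_from \<nu> v" using uv by (intro N.real_distribution_lift_from)
  have k: "(mean_angle \<mu> - mean_angle \<nu>) / (2 * pi) = angle_cdf \<nu> v - angle_cdf \<mu> u"
    using mean by (simp add: M.integral_lift_from[OF uv(1)] N.integral_lift_from[OF uv(2)] field_simps)
  define a where "a t = angle_cdf \<mu> t - angle_cdf \<mu> u" for t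
  define b where "b t = angle_cdf \<nu> t - angle_cdf \<nu> v" for t
  define D where "D t = ennreal \<bar>cdf (circle_lift_from \<mu> u) t - cdf (circle_lift_from \<nu> v) t\<bar>" for t
  have [measurable]: "cdf (circle_lift_from \<mu> u) \<in> borel_measurable borel" "cdf (circle_lift_from \<nu> v) \<in> borel_measurable borel"
    by (intro borel_measurable_mono monoI Mu.cdf_nondecreasing Nv.cdf_nondecreasing; assumption)+
  have D_meas [measurable]: "D \<in> borel_measurable borel" unfolding D_def by measurable
  \<comment> \<open>Outside [0, 4 pi) both distribution functions are 0 or both are 1, so only two
    turns contribute.\<close>
  have "D t \<le> D t * indicator {0..<2*pi} t + D t * indicator {2*pi..<4*pi} t" for t
  proof -
    consider "t < 0" | "0 \<le> t" "t < 2 * pi" | "2 * pi \<le> t" "t < 4 * pi" | "4 * pi \<le> t" by linarith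
    then show ?thesis
      by cases (auto simp: D_def M.cdf_lift_from_cases(1,2)[OF uv(1)] N.cdf_lift_from_cases(1,2)[OF uv(2)] indicator_def)
  qed
  then have "(\<integral>\<^sup>+ t. D t \<partial>lborel) \<le> (\<integral>\<^sup>+ t. D t * indicator {0..<2*pi} t + D t * indicator {2*pi..<4*pi} t \<partial>lborel)"
    by (rule nn_integral_mono)
  also have "\<dots> = (\<integral>\<^sup>+ t. D t * indicator {0..<2*pi} t \<partial>lborel) + (\<integral>\<^sup>+ t. D t * indicator {2*pi..<4*pi} t \<partial>lborel)"
    by (rule nn_integral_add) auto
  also have "(\<integral>\<^sup>+ t. D t * indicator {2*pi..<4*pi} t \<partial>lborel) = (\<integral>\<^sup>+ t. D (2 * pi + t) * indicator {2*pi..<4*pi} (2 * pi + t) \<partial>lborel)"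
    by (subst nn_integral_real_affine[where c=1 and t="2*pi"]) auto
  also have "(\<integral>\<^sup>+ t. D t * indicator {0..<2*pi} t \<partial>lborel) + \<dots>
      = (\<integral>\<^sup>+ t. D t * indicator {0..<2*pi} t + D (2 * pi + t) * indicator {2*pi..<4*pi} (2 * pi + t) \<partial>lborel)"
    by (rule nn_integral_add[symmetric]) auto
  also have "\<dots> \<le> (\<integral>\<^sup>+ t. ennreal \<bar>a t - b t\<bar> * indicator {0..2*pi} t \<partial>lborel)"
  proof (rule nn_integral_mono)
    fix t :: real
    have "D t + D (2 * pi + t) = ennreal \<bar>a t - b t\<bar>" if t: "0 \<le> t" "t < 2 * pi"
      \<comment> \<open>Taking positive parts and taking negative parts are both monotone, so the
        two differences have the same sign and their absolute values add up to that of a - b without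
        loss.\<close>
      unfolding D_def M.cdf_lift_from_cases(3,4)[OF uv(1) t] N.cdf_lift_from_cases(3,4)[OF uv(2) t]
      by (simp add: a_def b_def ennreal_plus[symmetric] del: ennreal_plus)
    then show "D t * indicator {0..<2*pi} t + D (2 * pi + t) * indicator {2*pi..<4*pi} (2 * pi + t)
      \<le> ennreal \<bar>a t - b t\<bar> * indicator {0..2*pi} t"
      by (auto simp: indicator_def)
  qed
  finally have "(\<integral>\<^sup>+ t. D t \<partial>lborel) \<le> (\<integral>\<^sup>+ t. ennreal \<bar>a t - b t\<bar> * indicator {0..2*pi} t \<partial>lborel)" .
  moreover have "wasserstein 1 (circle_lift_from \<mu> u) (circle_lift_from \<nu> v) \<le> (\<integral>\<^sup>+ t. D t \<partial>lborel)"
    unfolding D_def by (intro wasserstein_1_le_cdf) unfold_locales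
  ultimately show ?thesis
    unfolding k a_def b_def by (simp add: algebra_simps)
qed

text \<open>This excludes the empty supremum. If \<open>\<mu>\<close> has the smaller mean angle,
  \<open>\<nu>\<close> is cut at 0 and the cut of \<open>\<mu>\<close> is moved from 0 to 2 pi,
  which raises its mean continuously by a full turn.\<close>

lemma exists_equal_mean_lifts:
  assumes "atomless_circle_prob \<mu>" "atomless_circle_prob \<nu>"
  shows "\<exists>u\<in>{0..2*pi}. \<exists>v\<in>{0..2*pi}. (\<integral>x. x \<partial>circle_lift_from \<mu> u) = (\<integral>x. x \<partial>circle_lift_from \<nu> v)"
  using assms
proof (induction "mean_angle \<mu>" "mean_angle \<nu>" arbitrary: \<mu> \<nu> rule: linorder_wlog)
  case (sym \<mu> \<nu>)
  then show ?case by metis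
next
  case (le \<mu> \<nu>)
  interpret M: atomless_circle_prob \<mu> by fact
  interpret N: atomless_circle_prob \<nu> by fact
  let ?d = "(mean_angle \<nu> - mean_angle \<mu>) / (2 * pi)"
  have "0 \<le> ?d" "?d \<le> 1" using le M.mean_angle_bounds N.mean_angle_bounds by auto
  then have "\<exists>u\<ge>0. u \<le> 2 * pi \<and> angle_cdf \<mu> u = ?d"
    \<comment> \<open>Both mean angles lie in [0, 2 pi], so the required mass \<open>?d\<close> is
      between the values 0 and 1 of the distribution function at the ends.\<close>
    by (intro IVT') (auto simp: M.angle_cdf_0 M.angle_cdf_2pi M.continuous_angle_cdf)
  then obtain u where "u \<in> {0..2*pi}" "angle_cdf \<mu> u = ?d" by auto
  moreover have "0 \<in> {0..2*pi}" by auto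
  ultimately show ?case
    using M.integral_lift_from[of u] N.integral_lift_from[of 0]
    by (intro bexI[of _ u] bexI[of _ 0]) (auto simp: N.angle_cdf_0)
qed

lemma circle_wasserstein_1_le:
  assumes "atomless_circle_prob \<mu>" "atomless_circle_prob \<nu>"
  shows "circle_wasserstein 1 \<mu> \<nu>
    \<le> (\<integral>\<^sup>+ t. ennreal \<bar>angle_cdf \<mu> t - angle_cdf \<nu> t + (mean_angle \<mu> - mean_angle \<nu>) / (2 * pi)\<bar> * indicator {0..2*pi} t \<partial>lborel)"
  using exists_equal_mean_lifts[OF assms] wasserstein_lift_from_le[OF assms]
  unfolding circle_wasserstein_def Let_def by (auto intro!: Sup_least)

section \<open>The logarithmic kernel\<close>

lemma cnj_measurable [measurable]: "cnj \<in> borel_measurable borel"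
  by (intro borel_measurable_continuous_onI continuous_intros)

locale circle_prob_pair = M: circle_prob \<mu> + N: circle_prob \<nu> for \<mu> \<nu>
begin

sublocale pair_prob_space \<mu> \<nu> ..

lemma measurable_fst_snd [measurable]:
  "fst \<in> \<mu> \<Otimes>\<^sub>M \<nu> \<rightarrow>\<^sub>M borel" "snd \<in> \<mu> \<Otimes>\<^sub>M \<nu> \<rightarrow>\<^sub>M borel"
  using measurable_compose[OF measurable_fst M.measurable_circle, of \<nu>] measurable_compose[OF measurable_snd N.measurable_circle, of \<mu>]
  by (simp_all add: eta_contract_eq)

lemma norm_pair: "p \<in> space (\<mu> \<Otimes>\<^sub>M \<nu>) \<Longrightarrow> norm (fst p) = 1 \<and> norm (snd p) = 1"
  by (auto simp: space_pair_measure M.norm_circle N.norm_circle)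

lemma norm_diff_le_2: "p \<in> space (\<mu> \<Otimes>\<^sub>M \<nu>) \<Longrightarrow> norm (fst p - snd p) \<le> 2"
  using norm_triangle_ineq4[of "fst p" "snd p"] norm_pair[of p] by simp

end

text \<open>On the diagonal this has the junk value \<^term>\<open>ln (0::real) = 0\<close>; the diagonal is null when the energy is finite.\<close>

definition log_norm :: "complex \<times> complex \<Rightarrow> real" where
  "log_norm p = ln (norm (fst p - snd p))"

text \<open>Chords have length at most 2, so subtracting the kernel from ln 2 leaves a nonnegative
  function. It carries the true infinite value on the diagonal and can be integrated in
  \<open>ennreal\<close> whether or not the energy is finite.\<close>

definition log_gap :: "complex \<times> complex \<Rightarrow> ennreal" where
  "log_gap p = (if fst p = snd p then \<top> else ennreal (ln 2 - log_norm p))"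

context circle_prob_pair
begin

lemma log_norm_measurable [measurable]: "log_norm \<in> borel_measurable (\<mu> \<Otimes>\<^sub>M \<nu>)"
  unfolding log_norm_def[abs_def] by measurable

lemma log_gap_measurable [measurable]: "log_gap \<in> borel_measurable (\<mu> \<Otimes>\<^sub>M \<nu>)"
  unfolding log_gap_def[abs_def] by measurable

lemma log_norm_le: "p \<in> space (\<mu> \<Otimes>\<^sub>M \<nu>) \<Longrightarrow> log_norm p \<le> ln 2"
  using norm_diff_le_2[of p] unfolding log_norm_def by (cases "fst p = snd p") auto

abbreviation "finite_gap \<equiv> (\<integral>\<^sup>+ p. log_gap p \<partial>(\<mu> \<Otimes>\<^sub>M \<nu>)) < \<top>"

lemma finite_gap_AE: "finite_gap \<Longrightarrow> AE p in \<mu> \<Otimes>\<^sub>M \<nu>. fst p \<noteq> snd p"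
proof -
  assume "finite_gap"
  then have "AE p in \<mu> \<Otimes>\<^sub>M \<nu>. log_gap p \<noteq> \<infinity>"
    by (intro nn_integral_PInf_AE) (auto simp: infinity_ennreal_def)
  then show ?thesis by eventually_elim (auto simp: log_gap_def infinity_ennreal_def)
qed

lemma finite_gap_integrable:
  assumes "finite_gap"
  shows "integrable (\<mu> \<Otimes>\<^sub>M \<nu>) log_norm"
    and "(\<integral>\<^sup>+ p. log_gap p \<partial>(\<mu> \<Otimes>\<^sub>M \<nu>)) = ennreal (ln 2 - (\<integral>p. log_norm p \<partial>(\<mu> \<Otimes>\<^sub>M \<nu>)))"
proof -
  have eq: "(\<integral>\<^sup>+ p. log_gap p \<partial>(\<mu> \<Otimes>\<^sub>M \<nu>)) = (\<integral>\<^sup>+ p. ennreal (ln 2 - log_norm p) \<partial>(\<mu> \<Otimes>\<^sub>M \<nu>))"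
    using finite_gap_AE[OF assms] by (intro nn_integral_cong_AE) (auto simp: log_gap_def)
  have nn: "AE p in \<mu> \<Otimes>\<^sub>M \<nu>. 0 \<le> ln 2 - log_norm p"
    by (rule AE_I2) (simp add: log_norm_le)
  have i: "integrable (\<mu> \<Otimes>\<^sub>M \<nu>) (\<lambda>p. ln 2 - log_norm p)"
    by (rule integrableI_nonneg) (use eq assms nn in auto)
  have "(\<lambda>p. ln 2 - (ln 2 - log_norm p)) = log_norm" by (simp add: fun_eq_iff)
  then show *: "integrable (\<mu> \<Otimes>\<^sub>M \<nu>) log_norm"
    using Bochner_Integration.integrable_diff[OF integrable_const i, of "ln 2"] by (simp only:)
  show "(\<integral>\<^sup>+ p. log_gap p \<partial>(\<mu> \<Otimes>\<^sub>M \<nu>)) = ennreal (ln 2 - (\<integral>p. log_norm p \<partial>(\<mu> \<Otimes>\<^sub>M \<nu>)))"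
    unfolding eq using nn_integral_eq_integral[OF i nn] * prob_space
    by (simp add: Bochner_Integration.integral_diff)
qed

lemma log_integral_finite_gap:
  assumes "finite_gap"
  shows "log_integral \<mu> \<nu> = ereal (\<integral>p. log_norm p \<partial>(\<mu> \<Otimes>\<^sub>M \<nu>))"
proof -
  note i = finite_gap_integrable(1)[OF assms]
  have "(\<integral>\<^sup>+ p. e2ennreal ((\<lambda>(z, w). log_dist z w) p) \<partial>(\<mu> \<Otimes>\<^sub>M \<nu>)) = (\<integral>\<^sup>+ p. ennreal (log_norm p) \<partial>(\<mu> \<Otimes>\<^sub>M \<nu>))"
    using finite_gap_AE[OF assms]
    by (intro nn_integral_cong_AE) (auto simp: log_dist_def log_norm_def split_def ennreal.abs_eq ennreal_def e2ennreal_def)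
  moreover have "(\<integral>\<^sup>+ p. e2ennreal (- (\<lambda>(z, w). log_dist z w) p) \<partial>(\<mu> \<Otimes>\<^sub>M \<nu>)) = (\<integral>\<^sup>+ p. ennreal (- log_norm p) \<partial>(\<mu> \<Otimes>\<^sub>M \<nu>))"
    using finite_gap_AE[OF assms]
    by (intro nn_integral_cong_AE) (auto simp: log_dist_def log_norm_def split_def)
  moreover obtain a b where "(\<integral>\<^sup>+ p. ennreal (log_norm p) \<partial>(\<mu> \<Otimes>\<^sub>M \<nu>)) = ennreal a" "0 \<le> a"
      "(\<integral>\<^sup>+ p. ennreal (- log_norm p) \<partial>(\<mu> \<Otimes>\<^sub>M \<nu>)) = ennreal b" "0 \<le> b"
    using i unfolding real_integrable_def by (metis ennreal_cases infinity_ennreal_def)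
  ultimately show ?thesis
    using real_lebesgue_integral_def[OF i]
    by (simp add: log_integral_def ereal_integral_def)
qed

text \<open>The positive part of the kernel is at most ln 2, so an infinite gap must come from the
  negative part, and no difference of two infinities arises.\<close>

lemma log_integral_infinite_gap:
  assumes "\<not> finite_gap"
  shows "log_integral \<mu> \<nu> = - \<infinity>"
proof -
  let ?f = "\<lambda>p. (\<lambda>(z, w). log_dist z w) p"
  have [measurable]: "(\<lambda>p. e2ennreal (- ?f p)) \<in> borel_measurable (\<mu> \<Otimes>\<^sub>M \<nu>)"
    unfolding log_dist_def split_def by measurable
  have "\<top> = (\<integral>\<^sup>+ p. log_gap p \<partial>(\<mu> \<Otimes>\<^sub>M \<nu>))" using assms by (simp add: less_top[symmetric])
  also have "\<dots> \<le> (\<integral>\<^sup>+ p. ennreal (ln 2) + e2ennreal (- ?f p) \<partial>(\<mu> \<Otimes>\<^sub>M \<nu>))"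
  proof (rule nn_integral_mono)
    fix p assume "p \<in> space (\<mu> \<Otimes>\<^sub>M \<nu>)"
    show "log_gap p \<le> ennreal (ln 2) + e2ennreal (- ?f p)"
    proof (cases "fst p = snd p")
      case False
      have "ennreal (ln 2 - log_norm p) \<le> ennreal (ln 2) + ennreal (- log_norm p)"
        by (cases "log_norm p \<le> 0") (auto simp: ennreal_plus[symmetric] ennreal_neg intro: ennreal_leI simp del: ennreal_plus)
      then show ?thesis using False by (simp add: log_gap_def log_dist_def split_def log_norm_def)
    qed (simp add: log_dist_def split_def)
  qed
  also have "\<dots> = ennreal (ln 2) + (\<integral>\<^sup>+ p. e2ennreal (- ?f p) \<partial>(\<mu> \<Otimes>\<^sub>M \<nu>))"
    by (subst nn_integral_add) (auto simp: emeasure_space_1)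
  finally have neg: "(\<integral>\<^sup>+ p. e2ennreal (- ?f p) \<partial>(\<mu> \<Otimes>\<^sub>M \<nu>)) = \<top>"
    by (simp add: top_unique)
  have "(\<integral>\<^sup>+ p. e2ennreal (?f p) \<partial>(\<mu> \<Otimes>\<^sub>M \<nu>)) \<le> (\<integral>\<^sup>+ p. ennreal (ln 2) \<partial>(\<mu> \<Otimes>\<^sub>M \<nu>))"
  proof (rule nn_integral_mono)
    show "e2ennreal (?f p) \<le> ennreal (ln 2)" if "p \<in> space (\<mu> \<Otimes>\<^sub>M \<nu>)" for p
      using log_norm_le[OF that] by (auto simp: e2ennreal_neg log_dist_def split_def log_norm_def intro: ennreal_leI)
  qed
  also have "\<dots> = ennreal (ln 2)" by (simp add: emeasure_space_1)
  finally obtain a where "(\<integral>\<^sup>+ p. e2ennreal (?f p) \<partial>(\<mu> \<Otimes>\<^sub>M \<nu>)) = ennreal a" "0 \<le> a"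
    by (metis ennreal_cases neq_top_trans ennreal_neq_top)
  then show ?thesis
    unfolding log_integral_def ereal_integral_def neg by simp
qed

lemma log_integral_gt_iff: "log_integral \<mu> \<nu> > - \<infinity> \<longleftrightarrow> finite_gap"
  using log_integral_finite_gap log_integral_infinite_gap by (cases finite_gap) auto

end

text \<open>An atom z would give the point (z, z) positive product mass, but the gap is infinite on
  the diagonal, which is therefore null.\<close>

lemma (in circle_prob) atomless_of_finite_log_energy:
  assumes "finite_log_energy \<mu>"
  shows "atomless_circle_prob \<mu>"
proof
  note times = emeasure_pair_measure_Times
  interpret circle_prob_pair \<mu> \<mu> ..
  fix z :: complex assume z: "norm z = 1"
  have "{w \<in> space \<mu>. w = z} \<in> sets \<mu>" by measurable
  also have "{w \<in> space \<mu>. w = z} = {z}" using z by (auto simp: space_circle)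
  finally have [measurable]: "{z} \<in> sets \<mu>" .
  have diag': "{p \<in> space (\<mu> \<Otimes>\<^sub>M \<mu>). fst p = snd p} \<in> sets (\<mu> \<Otimes>\<^sub>M \<mu>)"
    by measurable
  then have diag: "{p \<in> space (\<mu> \<Otimes>\<^sub>M \<mu>). \<not> fst p \<noteq> snd p} \<in> sets (\<mu> \<Otimes>\<^sub>M \<mu>)"
    by simp
  have "AE p in \<mu> \<Otimes>\<^sub>M \<mu>. fst p \<noteq> snd p"
    using assms finite_gap_AE log_integral_gt_iff by (simp add: finite_log_energy_def)
  then have "emeasure (\<mu> \<Otimes>\<^sub>M \<mu>) {p \<in> space (\<mu> \<Otimes>\<^sub>M \<mu>). fst p = snd p} = 0"
    by (subst (asm) AE_iff_measurable[OF diag refl]) (simp add: Collect_conj_eq)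
  moreover have "emeasure (\<mu> \<Otimes>\<^sub>M \<mu>) ({z} \<times> {z}) \<le> emeasure (\<mu> \<Otimes>\<^sub>M \<mu>) {p \<in> space (\<mu> \<Otimes>\<^sub>M \<mu>). fst p = snd p}"
    using z by (intro emeasure_mono diag') (auto simp: space_pair_measure space_circle)
  ultimately have "emeasure (\<mu> \<Otimes>\<^sub>M \<mu>) ({z} \<times> {z}) = 0" by simp
  then have "emeasure \<mu> {z} * emeasure \<mu> {z} = 0"
    using times[OF \<open>{z} \<in> sets \<mu>\<close> \<open>{z} \<in> sets \<mu>\<close>] by simp
  then show "measure \<mu> {z} = 0" by (simp add: measure_def)
qed

section \<open>Abel means of the logarithmic energy\<close>

definition circle_coeff :: "complex measure \<Rightarrow> nat \<Rightarrow> complex" where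
  "circle_coeff \<mu> k = (\<integral>z. z ^ k \<partial>\<mu>)"

lemma Re_real_mult_divide: "Re (of_real c * w / of_nat k) = c / k * Re w"
  by (simp add: Re_divide_of_nat)

text \<open>The closed disc of radius \<open>r\<close> < 1 about 1 is compact and misses the branch
  cut, so \<open>Ln\<close> is bounded on it.\<close>

lemma integrable_Ln:
  fixes X :: "'a \<Rightarrow> complex"
  assumes "finite_measure M" and [measurable]: "X \<in> borel_measurable M"
    and X: "\<And>x. x \<in> space M \<Longrightarrow> norm (X x) \<le> r" and r: "0 \<le> r" "r < 1"
  shows "integrable M (\<lambda>x. Ln (1 - X x))"
proof -
  interpret finite_measure M by fact
  have "z \<notin> \<real>\<^sub>\<le>\<^sub>0" if "z \<in> cball 1 r" for z :: complex
    using that r abs_Re_le_cmod[of "1 - z"] by (auto simp: dist_norm complex_nonpos_Reals_iff)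
  then have "continuous_on (cball 1 r) Ln"
    by (intro continuous_on_Ln continuous_on_id) auto
  then have "bounded (Ln ` cball 1 r)"
    by (intro compact_imp_bounded compact_continuous_image) auto
  then obtain B where B: "\<And>z. z \<in> cball 1 r \<Longrightarrow> norm (Ln z) \<le> B"
    unfolding bounded_iff by blast
  show ?thesis
    by (rule integrable_const_bound[where B=B]) (use B X in \<open>auto simp: dist_norm\<close>)
qed

text \<open>The power series of -Ln (1 - x) is integrated term by term under the geometric majorant
  r^k. Its term at k = 0 is a division by zero, hence 0, so sums from 0 agree with the series from
  1.\<close>

lemma sums_integral_Ln:
  fixes X :: "'a \<Rightarrow> complex"
  assumes "finite_measure M" and [measurable]: "X \<in> borel_measurable M"
    and X: "\<And>x. x \<in> space M \<Longrightarrow> norm (X x) \<le> r" and r: "0 \<le> r" "r < 1"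
  shows "(\<lambda>k. (\<integral>x. X x ^ k \<partial>M) / of_nat k) sums (\<integral>x. - Ln (1 - X x) \<partial>M)"
proof -
  interpret finite_measure M by fact
  have nx: "norm (X x ^ k / of_nat k) \<le> r ^ k" if "x \<in> space M" for x k
  proof (cases "k = 0")
    case False
    have "norm (X x ^ k / of_nat k) = norm (X x) ^ k / k" by (simp add: norm_divide norm_power)
    also have "\<dots> \<le> r ^ k / 1" using X[OF that] False r by (intro frac_le power_mono) auto
    finally show ?thesis by simp
  qed (simp add: r)
  have int: "integrable M (\<lambda>x. X x ^ k / of_nat k)" for k
    by (rule integrable_const_bound[where B="r^k"]) (auto simp: nx)
  have sm: "summable (\<lambda>k. r ^ k)" using r by (intro summable_geometric) auto
  have *: "(\<lambda>k. (\<integral>x. X x ^ k / of_nat k \<partial>M)) sums (\<integral>x. (\<Sum>k. X x ^ k / of_nat k) \<partial>M)"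
  proof (rule sums_integral[OF int])
    show "AE x in M. summable (\<lambda>k. norm (X x ^ k / of_nat k))"
      by (rule AE_I2, rule summable_comparison_test'[OF sm, of 0]) (simp add: nx del: norm_divide norm_power norm_mult)
    show "summable (\<lambda>k. \<integral>x. norm (X x ^ k / of_nat k) \<partial>M)"
    proof (rule summable_comparison_test'[OF summable_mult[OF sm, of "measure M (space M)"], of 0])
      fix k
      have "(\<integral>x. norm (X x ^ k / of_nat k) \<partial>M) \<le> (\<integral>x. r ^ k \<partial>M)"
        by (rule integral_mono) (use int nx in \<open>auto intro: integrable_norm simp del: norm_divide norm_power norm_mult\<close>)
      then show "norm (\<integral>x. norm (X x ^ k / of_nat k) \<partial>M) \<le> measure M (space M) * r ^ k"
        by (simp del: norm_divide norm_power norm_mult)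
    qed
  qed
  have "(\<Sum>k. X x ^ k / of_nat k) = - Ln (1 - X x)" if "x \<in> space M" for x
  proof -
    have "norm (- X x) < 1" using X[OF that] r by simp
    from sums_minus[OF Ln_series'[OF this]] show ?thesis by (simp add: sums_iff)
  qed
  then have "(\<integral>x. (\<Sum>k. X x ^ k / of_nat k) \<partial>M) = (\<integral>x. - Ln (1 - X x) \<partial>M)"
    by (intro Bochner_Integration.integral_cong) auto
  with * show ?thesis by simp
qed

lemma (in circle_prob) norm_circle_coeff_le: "norm (circle_coeff \<mu> k) \<le> 1"
proof -
  have "norm (circle_coeff \<mu> k) \<le> (\<integral>z. norm (z ^ k) \<partial>\<mu>)"
    unfolding circle_coeff_def by (rule integral_norm_bound)
  also have "\<dots> = (\<integral>z. 1 \<partial>\<mu>)"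
    by (intro Bochner_Integration.integral_cong) (auto simp: norm_power norm_circle)
  finally show ?thesis by (simp add: prob_space)
qed

context circle_prob_pair
begin

text \<open>On the unit circle |z - w| = |1 - z cnj w|. Inserting a factor r < 1 keeps the argument
  of the logarithm away from 0, so this smoothed energy is finite for every pair of
  measures.\<close>

definition abel_energy :: "real \<Rightarrow> real" where
  "abel_energy r = (\<integral>p. - ln (norm (1 - of_real r * fst p * cnj (snd p))) \<partial>(\<mu> \<Otimes>\<^sub>M \<nu>))"

lemma integral_monomial: "(\<integral>p. (fst p * cnj (snd p)) ^ k \<partial>(\<mu> \<Otimes>\<^sub>M \<nu>)) = circle_coeff \<mu> k * cnj (circle_coeff \<nu> k)"
proof -
  have i: "integrable (\<mu> \<Otimes>\<^sub>M \<nu>) (\<lambda>p. (fst p * cnj (snd p)) ^ k)"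
    by (rule integrable_const_bound[where B=1]) (use norm_pair in \<open>auto simp: norm_power norm_mult power_mult_distrib\<close>)
  show ?thesis
    unfolding integral_fst'[OF i, symmetric] circle_coeff_def
    by (simp add: power_mult_distrib flip: complex_cnj_power)
qed

lemma norm_scaled: "p \<in> space (\<mu> \<Otimes>\<^sub>M \<nu>) \<Longrightarrow> 0 \<le> r \<Longrightarrow> norm (of_real r * fst p * cnj (snd p)) = r"
  using norm_pair[of p] by (simp add: norm_mult)

text \<open>The monomials in z cnj w split under the product measure into coefficients of the two
  measures, and real parts turn \<open>Ln\<close> into the logarithm of the modulus.\<close>

lemma abel_energy_sums:
  assumes r: "0 \<le> r" "r < 1"
  shows "(\<lambda>k. r ^ k / k * Re (circle_coeff \<mu> k * cnj (circle_coeff \<nu> k))) sums abel_energy r"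
proof -
  let ?X = "\<lambda>p. of_real r * fst p * cnj (snd p)"
  have s: "(\<lambda>k. (\<integral>p. ?X p ^ k \<partial>(\<mu> \<Otimes>\<^sub>M \<nu>)) / of_nat k) sums (\<integral>p. - Ln (1 - ?X p) \<partial>(\<mu> \<Otimes>\<^sub>M \<nu>))"
    by (rule sums_integral_Ln[OF _ _ _ r]) (use r in \<open>auto simp: norm_scaled intro: finite_measure_axioms\<close>)
  have "(\<integral>p. ?X p ^ k \<partial>(\<mu> \<Otimes>\<^sub>M \<nu>)) = of_real (r ^ k) * (circle_coeff \<mu> k * cnj (circle_coeff \<nu> k))" for k
    using integral_monomial[of k] by (simp add: power_mult_distrib mult.assoc)
  with s have s: "(\<lambda>k. of_real (r ^ k) * (circle_coeff \<mu> k * cnj (circle_coeff \<nu> k)) / of_nat k) sums (\<integral>p. - Ln (1 - ?X p) \<partial>(\<mu> \<Otimes>\<^sub>M \<nu>))"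
    by simp
  have ne: "1 - ?X p \<noteq> 0" if "p \<in> space (\<mu> \<Otimes>\<^sub>M \<nu>)" for p
    using norm_scaled[OF that, of r] r by (metis eq_iff_diff_eq_0 norm_one less_irrefl)
  have int: "integrable (\<mu> \<Otimes>\<^sub>M \<nu>) (\<lambda>p. - Ln (1 - ?X p))"
    by (intro integrable_minus integrable_Ln[OF _ _ _ r]) (use r in \<open>auto simp: norm_scaled intro: finite_measure_axioms\<close>)
  have "(\<lambda>k. Re (of_real (r ^ k) * (circle_coeff \<mu> k * cnj (circle_coeff \<nu> k)) / of_nat k)) sums Re (\<integral>p. - Ln (1 - ?X p) \<partial>(\<mu> \<Otimes>\<^sub>M \<nu>))"
    by (rule sums_Re[OF s])
  also have "Re (\<integral>p. - Ln (1 - ?X p) \<partial>(\<mu> \<Otimes>\<^sub>M \<nu>)) = (\<integral>p. Re (- Ln (1 - ?X p)) \<partial>(\<mu> \<Otimes>\<^sub>M \<nu>))"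
    by (rule integral_Re[OF int, symmetric])
  also have "\<dots> = abel_energy r"
    unfolding abel_energy_def by (intro Bochner_Integration.integral_cong) (use ne in auto)
  also have "(\<lambda>k. Re (of_real (r ^ k) * (circle_coeff \<mu> k * cnj (circle_coeff \<nu> k)) / of_nat k))
    = (\<lambda>k. r ^ k / k * Re (circle_coeff \<mu> k * cnj (circle_coeff \<nu> k)))"
    by (simp only: Re_real_mult_divide)
  finally show ?thesis .
qed

end

section \<open>Square integrals of one-sided trigonometric series\<close>

lemma integral_cis_period:
  "(\<integral>t. cis (of_int m * t) \<partial>restrict_space lborel {0..2*pi}) = (if m = 0 then 2 * pi else 0)"
proof (cases "m = 0")
  case True
  have "measure (restrict_space lborel {0..2*pi}) {0..2*pi} = 2 * pi"
    by (subst measure_restrict_space) auto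
  with True show ?thesis by (simp add: space_restrict_space scaleR_conv_of_real)
next
  case False
  have "(\<integral>t. indicator {0..2*pi} t *\<^sub>R cis (of_int m * t) \<partial>lborel)
     = cis (of_int m * (2 * pi)) / (\<i> * of_int m) - cis (of_int m * 0) / (\<i> * of_int m)"
  proof (rule integral_FTC_Icc)
    show "((\<lambda>t. cis (of_int m * t) / (\<i> * of_int m)) has_vector_derivative cis (of_int m * t)) (at t within {0..2*pi})" for t
      unfolding cis_conv_exp using False
      by (auto intro!: derivative_eq_intros has_vector_derivative_real_field) (simp add: mult_ac)
    show "continuous_on {0..2*pi} (\<lambda>t. cis (of_int m * t))" by (intro continuous_intros)
  qed simp
  also have "cis (of_int m * (2 * pi)) = 1"
    using cis_multiple_2pi[of "of_int m"] by (simp add: mult_ac)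
  finally show ?thesis using False by (simp add: integral_restrict_space)
qed

lemma finite_measure_period: "finite_measure (restrict_space lborel {0..2*pi})"
  by (rule finite_measureI) (simp add: emeasure_restrict_space space_restrict_space)

lemma Im_square: "(Im w)\<^sup>2 = Re (w * cnj w - w * w) / 2"
  by (simp add: power2_eq_square)

text \<open>Orthogonality of the characters; the sum has no constant term and no negative frequencies, so the
  integral of its square vanishes.\<close>

lemma integral_Im_trig_sum:
  fixes a :: "nat \<Rightarrow> complex"
  assumes "a 0 = 0"
  shows "(\<integral>t. (Im (\<Sum>k<n. a k * cis (real k * t)))\<^sup>2 \<partial>restrict_space lborel {0..2*pi}) = pi * (\<Sum>k<n. (norm (a k))\<^sup>2)"
proof -
  let ?L = "restrict_space lborel {0..2*pi} :: real measure"
  let ?f = "\<lambda>t::real. \<Sum>k<n. a k * cis (real k * t)"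
  interpret finite_measure ?L by (rule finite_measure_period)
  have cm: "(\<lambda>t. cis (of_int m * t)) \<in> borel_measurable ?L" for m
    by (intro measurable_restrict_space1) (simp add: borel_measurable_continuous_onI continuous_on_cis continuous_on_mult_left)
  have i: "integrable ?L (\<lambda>t. c * cis (of_int m * t))" for c m
    by (intro integrable_mult_right integrable_const_bound[where B=1]) (auto simp: cm)
  have e: "cis (of_int (int j - int k) * t) = cis (real j * t) * cnj (cis (real k * t))" for j k t
    by (simp add: cis_cnj cis_mult left_diff_distrib)
  have ff: "?f t * cnj (?f t) = (\<Sum>j<n. \<Sum>k<n. (a j * cnj (a k)) * cis (of_int (int j - int k) * t))" for t
    unfolding e by (simp add: sum_product mult_ac)
  have e': "cis (of_int (int j + int k) * t) = cis (real j * t) * cis (real k * t)" for j k t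
    by (simp add: cis_mult distrib_right)
  have gg: "?f t * ?f t = (\<Sum>j<n. \<Sum>k<n. (a j * a k) * cis (of_int (int j + int k) * t))" for t
    unfolding e' by (simp add: sum_product mult_ac)
  have I1: "(\<integral>t. ?f t * cnj (?f t) \<partial>?L) = (\<Sum>j<n. \<Sum>k<n. (a j * cnj (a k)) * (if int j - int k = 0 then 2 * pi else 0))"
    unfolding ff by (subst Bochner_Integration.integral_sum, (intro Bochner_Integration.integrable_sum i)[1])+
      (simp only: integral_cis_period integral_mult_right_zero)
  also have "\<dots> = of_real (2 * pi * (\<Sum>k<n. (norm (a k))\<^sup>2))"
    by (simp add: if_distrib cong: if_cong) (simp add: complex_norm_square sum_distrib_left mult_ac flip: of_real_power)
  finally have I1: "(\<integral>t. ?f t * cnj (?f t) \<partial>?L) = of_real (2 * pi * (\<Sum>k<n. (norm (a k))\<^sup>2))" .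
  have "(\<integral>t. ?f t * ?f t \<partial>?L) = (\<Sum>j<n. \<Sum>k<n. (a j * a k) * (if int j + int k = 0 then 2 * pi else 0))"
    unfolding gg by (subst Bochner_Integration.integral_sum, (intro Bochner_Integration.integrable_sum i)[1])+
      (simp only: integral_cis_period integral_mult_right_zero)
  also have "\<dots> = 0"
    \<comment> \<open>Among nonnegative frequencies only j = k = 0 sums to 0, and that term is
      removed by \<open>a 0 = 0\<close>.\<close>
    by (intro sum.neutral ballI) (auto simp: assms simp flip: of_nat_add)
  finally have I2: "(\<integral>t. ?f t * ?f t \<partial>?L) = 0" .
  have i1: "integrable ?L (\<lambda>t. ?f t * cnj (?f t))" unfolding ff by (intro Bochner_Integration.integrable_sum i)
  have i2: "integrable ?L (\<lambda>t. ?f t * ?f t)" unfolding gg by (intro Bochner_Integration.integrable_sum i)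
  have "(\<integral>t. (Im (?f t))\<^sup>2 \<partial>?L) = (\<integral>t. Re (?f t * cnj (?f t) - ?f t * ?f t) / 2 \<partial>?L)"
    by (simp only: Im_square)
  also have "\<dots> = Re (\<integral>t. ?f t * cnj (?f t) - ?f t * ?f t \<partial>?L) / 2"
    by (simp only: integral_divide_zero integral_Re[OF Bochner_Integration.integrable_diff[OF i1 i2]])
  also have "\<dots> = pi * (\<Sum>k<n. (norm (a k))\<^sup>2)"
    by (simp only: Bochner_Integration.integral_diff[OF i1 i2] I1 I2) simp
  finally show ?thesis .
qed

text \<open>A Parseval identity for the imaginary part. All partial sums are bounded by the sum of
  the coefficient norms, so dominated convergence carries over the finite case.\<close>

lemma integral_Im_trig_series:
  fixes a :: "nat \<Rightarrow> complex"
  assumes "a 0 = 0" and sa: "summable (\<lambda>k. norm (a k))"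
    and f: "\<And>t::real. (\<lambda>k. a k * cis (real k * t)) sums f t"
  shows "f \<in> borel_measurable borel"
    and "(\<lambda>k. pi * (norm (a k))\<^sup>2) sums (\<integral>t. (Im (f t))\<^sup>2 \<partial>restrict_space lborel {0..2*pi})"
proof -
  let ?L = "restrict_space lborel {0..2*pi} :: real measure"
  interpret finite_measure ?L by (rule finite_measure_period)
  have cm: "(\<lambda>t. \<Sum>k<n. a k * cis (real k * t)) \<in> borel_measurable borel" for n
    by (intro borel_measurable_continuous_onI continuous_intros)
  show fm [measurable]: "f \<in> borel_measurable borel"
    by (rule borel_measurable_LIMSEQ_metric[OF cm]) (use f in \<open>simp add: sums_def\<close>)
  let ?B = "\<Sum>k. norm (a k)"
  have "(\<lambda>n. \<integral>t. (Im (\<Sum>k<n. a k * cis (real k * t)))\<^sup>2 \<partial>?L) \<longlonglongrightarrow> (\<integral>t. (Im (f t))\<^sup>2 \<partial>?L)"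
  proof (rule integral_dominated_convergence)
    show "(\<lambda>t. (Im (f t))\<^sup>2) \<in> borel_measurable ?L"
      by (intro measurable_restrict_space1) simp
    show "(\<lambda>t. (Im (\<Sum>k<n. a k * cis (real k * t)))\<^sup>2) \<in> borel_measurable ?L" for n
      using cm[of n] by (intro measurable_restrict_space1) simp
    show "integrable ?L (\<lambda>t. ?B\<^sup>2)" by simp
    show "AE t in ?L. (\<lambda>n. (Im (\<Sum>k<n. a k * cis (real k * t)))\<^sup>2) \<longlonglongrightarrow> (Im (f t))\<^sup>2"
      using f by (intro AE_I2 tendsto_intros) (simp add: sums_def)
    show "AE t in ?L. norm ((Im (\<Sum>k<n. a k * cis (real k * t)))\<^sup>2) \<le> ?B\<^sup>2" for n
    proof (rule AE_I2)
      fix t :: real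
      have "\<bar>Im (\<Sum>k<n. a k * cis (real k * t))\<bar> \<le> norm (\<Sum>k<n. a k * cis (real k * t))"
        by (rule abs_Im_le_cmod)
      also have "\<dots> \<le> (\<Sum>k<n. norm (a k))"
        by (rule order_trans[OF norm_sum]) (simp add: norm_mult)
      also have "\<dots> \<le> ?B" by (rule sum_le_suminf[OF sa]) auto
      finally show "norm ((Im (\<Sum>k<n. a k * cis (real k * t)))\<^sup>2) \<le> ?B\<^sup>2"
        by (simp add: abs_le_square_iff[symmetric])
    qed
  qed
  then show "(\<lambda>k. pi * (norm (a k))\<^sup>2) sums (\<integral>t. (Im (f t))\<^sup>2 \<partial>?L)"
    unfolding integral_Im_trig_sum[where a=a, OF assms(1)] sums_def sum_distrib_left .
qed

section \<open>Convergence of the Abel means\<close>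

text \<open>The constant 2 arises as follows: with u = z cnj w, |1 - u| is at most |1 - r u| + (1 -
  r), and 1 - r is itself at most |1 - r u|.\<close>

lemma norm_one_minus_scaled:
  assumes z: "norm z = 1" "norm w = 1" and r: "0 \<le> r" "r < 1"
  shows "norm (z - w) / 2 \<le> norm (1 - of_real r * z * cnj w)"
    and "norm (1 - of_real r * z * cnj w) \<le> 2"
    and "0 < norm (1 - of_real r * z * cnj w)"
proof -
  let ?u = "z * cnj w"
  have u: "norm ?u = 1" using z by (simp add: norm_mult)
  have "w * cnj w = 1" using z by (simp add: complex_norm_square[symmetric])
  then have e: "(z - w) * cnj w = ?u - 1" by (simp add: algebra_simps)
  have "norm (z - w) = norm ((z - w) * cnj w)" using z by (simp only: norm_mult complex_mod_cnj)
  then have zw: "norm (z - w) = norm (1 - ?u)" unfolding e by (simp add: norm_minus_commute)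
  have "norm (1 - ?u) \<le> norm (1 - of_real r * ?u) + norm (of_real r * ?u - ?u)"
    using norm_triangle_ineq[of "1 - of_real r * ?u" "of_real r * ?u - ?u"] by simp
  also have "of_real r * ?u - ?u = of_real (r - 1) * ?u" by (simp add: algebra_simps)
  also have "norm (of_real (r - 1) * ?u) = 1 - r" using r u by (simp only: norm_mult norm_of_real) simp
  finally have "norm (1 - ?u) \<le> norm (1 - of_real r * ?u) + (1 - r)" .
  moreover have "1 - r \<le> norm (1 - of_real r * ?u)"
    using norm_triangle_ineq2[of 1 "of_real r * ?u"] u r by (simp add: norm_mult)
  ultimately show "norm (z - w) / 2 \<le> norm (1 - of_real r * z * cnj w)" "0 < norm (1 - of_real r * z * cnj w)"
    using zw r by (auto simp: mult.assoc)
  have "norm (1 - of_real r * ?u) \<le> 1 + r" using norm_triangle_ineq4[of 1 "of_real r * ?u"] u r by (simp add: norm_mult)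
  then show "norm (1 - of_real r * z * cnj w) \<le> 2" using r by (simp add: mult.assoc)
qed

context circle_prob_pair
begin

definition abel_log :: "real \<Rightarrow> complex \<times> complex \<Rightarrow> real" where
  "abel_log r p = ln (norm (1 - of_real r * fst p * cnj (snd p)))"

lemma abel_log_measurable [measurable]: "abel_log r \<in> borel_measurable (\<mu> \<Otimes>\<^sub>M \<nu>)"
  unfolding abel_log_def[abs_def] by measurable

lemma abel_energy_eq: "abel_energy r = - (\<integral>p. abel_log r p \<partial>(\<mu> \<Otimes>\<^sub>M \<nu>))"
  by (simp add: abel_energy_def abel_log_def[abs_def])

lemma abel_log_bounds:
  assumes p: "p \<in> space (\<mu> \<Otimes>\<^sub>M \<nu>)" and r: "0 \<le> r" "r < 1"
  shows "abel_log r p \<le> ln 2" and "fst p \<noteq> snd p \<Longrightarrow> log_norm p - ln 2 \<le> abel_log r p"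
proof -
  note b = norm_one_minus_scaled[OF conjunct1[OF norm_pair[OF p]] conjunct2[OF norm_pair[OF p]] r]
  show "abel_log r p \<le> ln 2" unfolding abel_log_def using b(2,3) by simp
  assume "fst p \<noteq> snd p"
  then have "log_norm p - ln 2 = ln (norm (fst p - snd p) / 2)" by (simp add: log_norm_def ln_div)
  also have "\<dots> \<le> abel_log r p" unfolding abel_log_def using b(1,3) \<open>fst p \<noteq> snd p\<close> by simp
  finally show "log_norm p - ln 2 \<le> abel_log r p" .
qed

lemma abel_log_integrable:
  assumes r: "0 \<le> r" "r < 1"
  shows "integrable (\<mu> \<Otimes>\<^sub>M \<nu>) (abel_log r)"
proof -
  have "integrable (\<mu> \<Otimes>\<^sub>M \<nu>) (\<lambda>p. Re (Ln (1 - of_real r * fst p * cnj (snd p))))"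
    by (intro integrable_Re integrable_Ln[OF _ _ _ r]) (use r in \<open>auto simp: norm_scaled intro: finite_measure_axioms\<close>)
  then show ?thesis
  proof (rule Bochner_Integration.integrable_cong[OF refl, THEN iffD1, rotated])
    show "Re (Ln (1 - of_real r * fst p * cnj (snd p))) = abel_log r p" if "p \<in> space (\<mu> \<Otimes>\<^sub>M \<nu>)" for p
      using norm_one_minus_scaled(3)[of "fst p" "snd p", OF _ _ r] norm_pair[OF that] by (simp add: abel_log_def)
  qed
qed

lemma abel_log_tendsto:
  assumes p: "p \<in> space (\<mu> \<Otimes>\<^sub>M \<nu>)" "fst p \<noteq> snd p" and lim: "r \<longlonglongrightarrow> 1"
  shows "(\<lambda>n. abel_log (r n) p) \<longlonglongrightarrow> log_norm p"
proof -
  let ?z = "fst p" and ?w = "snd p"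
  have n: "norm ?z = 1" "norm ?w = 1" using norm_pair[OF p(1)] by auto
  have "?w * cnj ?w = 1" using n by (simp add: complex_norm_square[symmetric])
  then have "(?z - ?w) * cnj ?w = - (1 - ?z * cnj ?w)" by (simp add: algebra_simps)
  then have zw: "norm (?z - ?w) = norm (1 - of_real 1 * ?z * cnj ?w)"
    by (metis n(2) norm_mult complex_mod_cnj mult.right_neutral norm_minus_cancel of_real_1 mult_1)
  then show ?thesis
    unfolding abel_log_def log_norm_def zw using p(2)
    by (intro tendsto_intros lim) (metis zw right_minus_eq norm_eq_zero)
qed

text \<open>Halving |z - w| in the domination costs the additive ln 2; the bound is uniform in
  \<open>r\<close>, as \<open>finite_gapI\<close> demands.\<close>

lemma abel_energy_le:
  assumes fg: "finite_gap" and r: "0 \<le> r" "r < 1"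
  shows "abel_energy r \<le> ln 2 - (\<integral>p. log_norm p \<partial>(\<mu> \<Otimes>\<^sub>M \<nu>))"
proof -
  have "(\<integral>p. log_norm p - ln 2 \<partial>(\<mu> \<Otimes>\<^sub>M \<nu>)) \<le> (\<integral>p. abel_log r p \<partial>(\<mu> \<Otimes>\<^sub>M \<nu>))"
    using finite_gap_AE[OF fg] finite_gap_integrable(1)[OF fg] abel_log_integrable[OF r] abel_log_bounds(2)[OF _ r]
    by (intro integral_mono_AE) auto
  then show ?thesis
    using finite_gap_integrable(1)[OF fg] prob_space by (simp add: abel_energy_eq)
qed

lemma abel_energy_tendsto:
  assumes fg: "finite_gap" and r: "\<And>n. 0 \<le> r n" "\<And>n. r n < 1" and lim: "r \<longlonglongrightarrow> 1"
  shows "(\<lambda>n. abel_energy (r n)) \<longlonglongrightarrow> - (\<integral>p. log_norm p \<partial>(\<mu> \<Otimes>\<^sub>M \<nu>))"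
  unfolding abel_energy_eq
proof (intro tendsto_minus integral_dominated_convergence)
  show "integrable (\<mu> \<Otimes>\<^sub>M \<nu>) (\<lambda>p. \<bar>log_norm p\<bar> + ln 2)"
    using finite_gap_integrable(1)[OF fg] by auto
  show "AE p in \<mu> \<Otimes>\<^sub>M \<nu>. (\<lambda>n. abel_log (r n) p) \<longlonglongrightarrow> log_norm p"
    using finite_gap_AE[OF fg] AE_space by eventually_elim (rule abel_log_tendsto[OF _ _ lim])
  show "AE p in \<mu> \<Otimes>\<^sub>M \<nu>. norm (abel_log (r n) p) \<le> \<bar>log_norm p\<bar> + ln 2" for n
    using finite_gap_AE[OF fg] AE_space
    by eventually_elim (use abel_log_bounds[OF _ r[of n]] in force)
qed auto

text \<open>By Fatou: the smoothed gaps converge pointwise to \<open>log_gap\<close>, and their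
  integrals are ln 2 plus the Abel energies. It yields finiteness of mutual energies and of the
  energy of the uniform measure, where integrability is not known beforehand.\<close>

lemma finite_gapI:
  assumes r: "\<And>n. 0 \<le> r n" "\<And>n. r n < 1" and lim: "r \<longlonglongrightarrow> 1" and C: "\<And>n. abel_energy (r n) \<le> C"
  shows "finite_gap"
proof -
  let ?g = "\<lambda>n p. ennreal (ln 2 - abel_log (r n) p)"
  have "(\<integral>\<^sup>+ p. log_gap p \<partial>(\<mu> \<Otimes>\<^sub>M \<nu>)) \<le> (\<integral>\<^sup>+ p. liminf (\<lambda>n. ?g n p) \<partial>(\<mu> \<Otimes>\<^sub>M \<nu>))"
  proof (rule nn_integral_mono)
    fix p assume p: "p \<in> space (\<mu> \<Otimes>\<^sub>M \<nu>)"
    have "(\<lambda>n. ?g n p) \<longlonglongrightarrow> log_gap p"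
    proof (cases "fst p = snd p")
      case False
      then show ?thesis
        using abel_log_tendsto[OF p False lim] by (auto simp: log_gap_def intro!: tendsto_intros)
    next
      case True
      \<comment> \<open>On the diagonal the smoothed kernel is ln (1 - r), which tends to minus
        infinity, in agreement with the value \<open>\<top>\<close> of the gap.\<close>
      have "fst p * cnj (snd p) = 1"
        using norm_pair[OF p] True by (simp add: complex_norm_square[symmetric])
      then have "1 - of_real (r n) * fst p * cnj (snd p) = of_real (1 - r n)" for n
        by (simp add: mult.assoc)
      then have al: "abel_log (r n) p = ln (1 - r n)" for n
        unfolding abel_log_def using r(2)[of n] by (simp only: norm_of_real)
      have "filterlim (\<lambda>n. 1 - r n) (at_right 0) sequentially"
        using r lim less_imp_neq[OF r(2)] by (auto simp: filterlim_at intro!: tendsto_eq_intros)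
      then have "filterlim (\<lambda>n. ln (1 - r n)) at_bot sequentially"
        by (rule filterlim_compose[OF ln_at_0])
      then have "filterlim (\<lambda>n. ln 2 - ln (1 - r n)) at_top sequentially"
        unfolding diff_conv_add_uminus
        by (intro filterlim_tendsto_add_at_top[OF tendsto_const]) (simp add: filterlim_uminus_at_top)
      then show ?thesis
        using True by (simp add: al log_gap_def ennreal_tendsto_top_eq_at_top)
    qed
    then show "log_gap p \<le> liminf (\<lambda>n. ?g n p)"
      by (simp add: lim_imp_Liminf)
  qed
  also have "\<dots> \<le> liminf (\<lambda>n. \<integral>\<^sup>+ p. ?g n p \<partial>(\<mu> \<Otimes>\<^sub>M \<nu>))"
    by (rule nn_integral_liminf) measurable
  also have "\<dots> \<le> ennreal (ln 2 + C)"
  proof (rule Liminf_le)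
    have "(\<integral>\<^sup>+ p. ?g n p \<partial>(\<mu> \<Otimes>\<^sub>M \<nu>)) = ennreal (\<integral>p. ln 2 - abel_log (r n) p \<partial>(\<mu> \<Otimes>\<^sub>M \<nu>))" for n
      using abel_log_integrable[OF r[of n]] abel_log_bounds(1)[OF _ r[of n]]
      by (intro nn_integral_eq_integral) auto
    also have "\<dots> n = ennreal (ln 2 + abel_energy (r n))" for n
      using abel_log_integrable[OF r[of n]] prob_space by (simp add: abel_energy_eq)
    finally have "(\<integral>\<^sup>+ p. ?g n p \<partial>(\<mu> \<Otimes>\<^sub>M \<nu>)) \<le> ennreal (ln 2 + C)" for n
      using C[of n] by (simp add: ennreal_leI)
    then show "\<forall>\<^sub>F n in sequentially. (\<integral>\<^sup>+ p. ?g n p \<partial>(\<mu> \<Otimes>\<^sub>M \<nu>)) \<le> ennreal (ln 2 + C)" by simp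
  qed simp
  also have "\<dots> < \<top>" by simp
  finally show ?thesis .
qed

end

section \<open>The smoothed primitive\<close>

text \<open>The sawtooth function: 1 - cis \<theta> = 2 sin (\<theta> / 2) cis ((\<theta> - pi) /
  2), with positive modulus and an angle strictly between -pi / 2 and pi / 2, hence the principal
  one.\<close>

lemma Im_Ln_one_minus_cis:
  assumes "0 < \<theta>" "\<theta> < 2 * pi"
  shows "Im (Ln (1 - cis \<theta>)) = (\<theta> - pi) / 2"
proof -
  have s: "sin (\<theta> / 2) > 0" using assms by (intro sin_gt_zero) auto
  have "1 - cis \<theta> = of_real (2 * sin (\<theta> / 2)) * cis ((\<theta> - pi) / 2)"
  proof (rule complex_eqI)
    have c: "cos ((\<theta> - pi) / 2) = sin (\<theta> / 2)" "sin ((\<theta> - pi) / 2) = - cos (\<theta> / 2)"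
      by (simp_all add: diff_divide_distrib cos_diff sin_diff)
    have "cos \<theta> = 1 - 2 * (sin (\<theta> / 2))\<^sup>2" "sin \<theta> = 2 * sin (\<theta> / 2) * cos (\<theta> / 2)"
      using cos_double_sin[of "\<theta> / 2"] sin_double[of "\<theta> / 2"] by simp_all
    then show "Re (1 - cis \<theta>) = Re (of_real (2 * sin (\<theta> / 2)) * cis ((\<theta> - pi) / 2))"
      "Im (1 - cis \<theta>) = Im (of_real (2 * sin (\<theta> / 2)) * cis ((\<theta> - pi) / 2))"
      by (simp_all add: c power2_eq_square)
  qed
  also have "\<dots> = exp (Complex (ln (2 * sin (\<theta> / 2))) ((\<theta> - pi) / 2))"
    using s by (simp add: exp_eq_polar)
  also have "Ln \<dots> = Complex (ln (2 * sin (\<theta> / 2))) ((\<theta> - pi) / 2)"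
    using assms by (intro Ln_exp) auto
  finally show ?thesis by simp
qed

context circle_prob
begin

text \<open>The real part is a smoothed logarithmic potential. The imaginary part, its harmonic
  conjugate, is pi times a smoothed mean-zero primitive of \<open>\<mu>\<close> minus the uniform
  measure.\<close>

definition abel_primitive :: "real \<Rightarrow> real \<Rightarrow> complex" where
  "abel_primitive r t = (\<integral>z. - Ln (1 - of_real r * cis t * cnj z) \<partial>\<mu>)"

lemma norm_scaled_cis: "z \<in> space \<mu> \<Longrightarrow> 0 \<le> r \<Longrightarrow> norm (of_real r * cis t * cnj z) = r"
  using norm_circle[of z] by (simp add: norm_mult)

lemma scaled_cis_measurable [measurable]: "(\<lambda>z. of_real r * cis t * cnj z) \<in> borel_measurable \<mu>"
  by (rule measurable_circleI) measurable

lemma abel_primitive_sums: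
  assumes r: "0 \<le> r" "r < 1"
  shows "(\<lambda>k. of_real (r ^ k / k) * cnj (circle_coeff \<mu> k) * cis (real k * t)) sums abel_primitive r t"
proof -
  have "(\<lambda>k. (\<integral>z. (of_real r * cis t * cnj z) ^ k \<partial>\<mu>) / of_nat k) sums abel_primitive r t"
    unfolding abel_primitive_def
    by (rule sums_integral_Ln[OF _ _ _ r]) (use r in \<open>auto simp: norm_scaled_cis intro: finite_measure_axioms\<close>)
  moreover have "(\<integral>z. (of_real r * cis t * cnj z) ^ k \<partial>\<mu>) = of_real (r ^ k) * cis (real k * t) * cnj (circle_coeff \<mu> k)" for k
    by (simp add: power_mult_distrib Complex.DeMoivre circle_coeff_def mult.assoc flip: complex_cnj_power)
  ultimately show ?thesis by (simp add: mult_ac)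
qed

lemma abel_primitive_Im:
  assumes r: "0 \<le> r" "r < 1"
  shows "Im (abel_primitive r t) = - (\<integral>z. Im (Ln (1 - of_real r * cis t * cnj z)) \<partial>\<mu>)"
proof -
  have "integrable \<mu> (\<lambda>z. Ln (1 - of_real r * cis t * cnj z))"
    by (rule integrable_Ln[OF _ _ _ r]) (use r in \<open>auto simp: norm_scaled_cis intro: finite_measure_axioms\<close>)
  then show ?thesis by (simp add: abel_primitive_def integral_Im)
qed

lemma Im_Ln_bounded:
  assumes "z \<in> space \<mu>" and r: "0 \<le> r" "r < 1"
  shows "\<bar>Im (Ln (1 - of_real r * cis t * cnj z))\<bar> \<le> pi"
proof -
  have "1 - of_real r * cis t * cnj z \<noteq> 0"
    using norm_scaled_cis[OF assms(1,2), of t] r by (metis eq_iff_diff_eq_0 norm_one less_irrefl)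
  from mpi_less_Im_Ln[OF this] Im_Ln_le_pi[OF this] show ?thesis by (simp add: abs_le_iff)
qed

lemma abel_primitive_Im_bounded:
  assumes r: "0 \<le> r" "r < 1"
  shows "\<bar>Im (abel_primitive r t)\<bar> \<le> pi"
proof -
  have "\<bar>\<integral>z. Im (Ln (1 - of_real r * cis t * cnj z)) \<partial>\<mu>\<bar> \<le> (\<integral>z. pi \<partial>\<mu>)"
  proof (rule order_trans[OF integral_abs_bound], rule integral_mono)
    show "integrable \<mu> (\<lambda>z. \<bar>Im (Ln (1 - of_real r * cis t * cnj z))\<bar>)"
      by (rule integrable_const_bound[where B=pi]) (use Im_Ln_bounded[OF _ r] in auto)
  qed (use Im_Ln_bounded[OF _ r] in auto)
  then show ?thesis by (simp add: abel_primitive_Im[OF r] prob_space)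
qed

end

text \<open>Pointwise the integrand tends to the sawtooth at t - Arg z. Its jump at Arg z = t
  integrates to the distribution function, its linear part to the mean angle. The jump itself is a
  null event because there are no atoms.\<close>

lemma (in atomless_circle_prob) abel_primitive_tendsto:
  assumes t: "0 \<le> t" "t < 2 * pi"
    and r: "\<And>n. 0 \<le> r n" "\<And>n. r n < 1" and lim: "r \<longlonglongrightarrow> 1"
  shows "(\<lambda>n. Im (abel_primitive (r n) t)) \<longlonglongrightarrow> pi * angle_cdf \<mu> t + (mean_angle \<mu> - t - pi) / 2"
proof -
  let ?g = "\<lambda>z. (t - Arg2pi z + pi) / 2 - pi * indicator {z \<in> space \<mu>. Arg2pi z \<le> t} z"
  have ae: "AE z in \<mu>. Arg2pi z \<noteq> t"
    by (subst AE_iff_measurable[OF _ refl]) (use measure_Arg2pi_eq in \<open>auto simp: emeasure_eq_measure\<close>)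
  have "(\<lambda>n. \<integral>z. Im (Ln (1 - of_real (r n) * cis t * cnj z)) \<partial>\<mu>) \<longlonglongrightarrow> (\<integral>z. ?g z \<partial>\<mu>)"
  proof (rule integral_dominated_convergence)
    show "integrable \<mu> (\<lambda>z. pi)" by simp
    show "AE z in \<mu>. norm (Im (Ln (1 - of_real (r n) * cis t * cnj z))) \<le> pi" for n
      using Im_Ln_bounded[OF _ r] by (intro AE_I2) simp
    show "AE z in \<mu>. (\<lambda>n. Im (Ln (1 - of_real (r n) * cis t * cnj z))) \<longlonglongrightarrow> ?g z"
      using ae AE_space
    proof eventually_elim
      case (elim z)
      define \<theta> where "\<theta> = t - Arg2pi z"
      have b: "0 \<le> Arg2pi z" "Arg2pi z < 2 * pi" by (rule Arg2pi_bounds)+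
      have z: "cnj z = cis (- Arg2pi z)" using cis_Arg2pi[of z] norm_circle[of z] elim by (metis cis_cnj)
      have cz: "cis t * cnj z = cis \<theta>" unfolding z \<theta>_def by (simp add: cis_mult)
      have g: "Im (Ln (1 - cis \<theta>)) = ?g z"
      proof (cases "Arg2pi z \<le> t")
        case True
        then have "Im (Ln (1 - cis \<theta>)) = (\<theta> - pi) / 2"
          using elim t b by (intro Im_Ln_one_minus_cis) (auto simp: \<theta>_def)
        then show ?thesis using True elim by (simp add: \<theta>_def field_simps)
      next
        case False
        \<comment> \<open>Here \<theta> is negative; adding a turn brings it into (0, 2 pi), where
          the sawtooth formula holds, and produces the jump.\<close>
        then have "Im (Ln (1 - cis (\<theta> + 2 * pi))) = (\<theta> + 2 * pi - pi) / 2"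
          using elim t b by (intro Im_Ln_one_minus_cis) (auto simp: \<theta>_def)
        moreover have "cis (\<theta> + 2 * pi) = cis \<theta>" by (simp flip: cis_mult)
        ultimately show ?thesis using False by (simp add: \<theta>_def field_simps)
      qed
      have "\<bar>Re (cis \<theta>)\<bar> \<le> 1" using abs_Re_le_cmod[of "cis \<theta>"] by simp
      moreover have "cis \<theta> \<noteq> 1"
      proof
        assume "cis \<theta> = 1"
        then have "cis t = cis (Arg2pi z)" unfolding \<theta>_def by (simp flip: cis_divide)
        then have "t = Arg2pi z" using Arg2pi_cis t b by metis
        then show False using elim by simp
      qed
      ultimately have "1 - cis \<theta> \<notin> \<real>\<^sub>\<le>\<^sub>0"
        by (auto simp: complex_nonpos_Reals_iff complex_eq_iff dest: antisym[OF cos_le_one])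
      then have "(\<lambda>n. Im (Ln (1 - of_real (r n) * cis \<theta>))) \<longlonglongrightarrow> Im (Ln (1 - of_real 1 * cis \<theta>))"
        by (intro tendsto_Im tendsto_Ln tendsto_diff tendsto_mult tendsto_const tendsto_of_real lim) simp
      then show ?case using g by (simp add: mult.assoc cz)
    qed
    have "(\<lambda>z. Ln (1 - of_real (r n) * cis t * cnj z)) \<in> borel_measurable \<mu>" for n
      by (intro measurable_compose[OF _ Ln_measurable] borel_measurable_diff scaled_cis_measurable) auto
    then show "(\<lambda>z. Im (Ln (1 - of_real (r n) * cis t * cnj z))) \<in> borel_measurable \<mu>" for n
      by simp
    show "?g \<in> borel_measurable \<mu>" by measurable
  qed
  moreover have "(\<integral>z. ?g z \<partial>\<mu>) = (t - mean_angle \<mu> + pi) / 2 - pi * angle_cdf \<mu> t"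
  proof -
    have i: "integrable \<mu> (indicator {z \<in> space \<mu>. Arg2pi z \<le> t} :: _ \<Rightarrow> real)"
      by (auto intro!: integrable_real_indicator simp: less_top[symmetric])
    have "(\<integral>z. ?g z \<partial>\<mu>) = (\<integral>z. (t - Arg2pi z + pi) / 2 \<partial>\<mu>) - (\<integral>z. pi * indicator {z \<in> space \<mu>. Arg2pi z \<le> t} z \<partial>\<mu>)"
      using integrable_Arg2pi i by (intro Bochner_Integration.integral_diff) auto
    also have "(\<integral>z. (t - Arg2pi z + pi) / 2 \<partial>\<mu>) = (t - mean_angle \<mu> + pi) / 2"
    proof -
      have "(\<integral>z. (t - Arg2pi z + pi) / 2 \<partial>\<mu>) = (\<integral>z. (t + pi) / 2 - Arg2pi z / 2 \<partial>\<mu>)"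
        by (intro Bochner_Integration.integral_cong) (auto simp: field_simps)
      also have "\<dots> = (\<integral>z. (t + pi) / 2 \<partial>\<mu>) - (\<integral>z. Arg2pi z / 2 \<partial>\<mu>)"
        using integrable_Arg2pi by (intro Bochner_Integration.integral_diff) auto
      finally show ?thesis by (simp add: mean_angle_def prob_space field_simps)
    qed
    also have "(\<integral>z. pi * indicator {z \<in> space \<mu>. Arg2pi z \<le> t} z \<partial>\<mu>) = pi * angle_cdf \<mu> t"
      by (simp add: angle_cdf_def)
    finally show ?thesis .
  qed
  ultimately have "(\<lambda>n. - (\<integral>z. Im (Ln (1 - of_real (r n) * cis t * cnj z)) \<partial>\<mu>))
     \<longlonglongrightarrow> - ((t - mean_angle \<mu> + pi) / 2 - pi * angle_cdf \<mu> t)"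
    by (intro tendsto_minus) simp
  also have "- ((t - mean_angle \<mu> + pi) / 2 - pi * angle_cdf \<mu> t) = pi * angle_cdf \<mu> t + (mean_angle \<mu> - t - pi) / 2"
    by (simp add: field_simps)
  finally show ?thesis by (simp only: abel_primitive_Im[OF r])
qed

section \<open>Energy and the height difference\<close>

definition height_difference :: "complex measure \<Rightarrow> complex measure \<Rightarrow> real \<Rightarrow> real" where
  "height_difference \<mu> \<nu> t = angle_cdf \<mu> t - angle_cdf \<nu> t + (mean_angle \<mu> - mean_angle \<nu>) / (2 * pi)"

lemma norm_diff_square: "(norm (a - b))\<^sup>2 = Re (a * cnj a) - Re (a * cnj b) - Re (b * cnj a) + Re (b * cnj b)"
  unfolding cmod_power2 by (simp add: power2_eq_square algebra_simps)

definition abel_rel_energy :: "complex measure \<Rightarrow> complex measure \<Rightarrow> real \<Rightarrow> real" where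
  "abel_rel_energy \<mu> \<nu> r = circle_prob_pair.abel_energy \<mu> \<mu> r - circle_prob_pair.abel_energy \<mu> \<nu> r
    - circle_prob_pair.abel_energy \<nu> \<mu> r + circle_prob_pair.abel_energy \<nu> \<nu> r"

lemma (in circle_prob_pair) abel_rel_energy_sums:
  assumes r: "0 \<le> r" "r < 1"
  shows "(\<lambda>k. r ^ k / k * (norm (circle_coeff \<mu> k - circle_coeff \<nu> k))\<^sup>2) sums abel_rel_energy \<mu> \<nu> r"
proof -
  interpret A: circle_prob_pair \<mu> \<mu> ..
  interpret B: circle_prob_pair \<nu> \<nu> ..
  interpret C: circle_prob_pair \<nu> \<mu> ..
  show ?thesis
    using sums_add[OF sums_diff[OF sums_diff[OF A.abel_energy_sums[OF r] abel_energy_sums[OF r]] C.abel_energy_sums[OF r]] B.abel_energy_sums[OF r]]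
    unfolding norm_diff_square abel_rel_energy_def by (simp only: distrib_left right_diff_distrib)
qed

text \<open>Termwise it is 2 Re (a cnj b) <= |a|^2 + |b|^2, with nonnegative weights r^k / k. The
  mutual Abel energy is thereby controlled while the mutual energy may still be infinite.\<close>

lemma (in circle_prob_pair) abel_energy_le_mean:
  assumes r: "0 \<le> r" "r < 1"
  shows "2 * abel_energy r \<le> circle_prob_pair.abel_energy \<mu> \<mu> r + circle_prob_pair.abel_energy \<nu> \<nu> r"
proof -
  interpret A: circle_prob_pair \<mu> \<mu> ..
  interpret B: circle_prob_pair \<nu> \<nu> ..
  have "Re (a * cnj a) + Re (b * cnj b) - 2 * Re (a * cnj b) = (norm (a - b))\<^sup>2" for a b
    by (simp add: norm_diff_square)
  then have le: "2 * Re (a * cnj b) \<le> Re (a * cnj a) + Re (b * cnj b)" for a b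
    by (metis zero_le_power2 diff_ge_0_iff_ge)
  show ?thesis
  proof (rule sums_le[OF _ sums_mult[OF abel_energy_sums[OF r], of 2] sums_add[OF A.abel_energy_sums[OF r] B.abel_energy_sums[OF r]]])
    fix k
    let ?a = "circle_coeff \<mu> k" and ?b = "circle_coeff \<nu> k"
    have "r ^ k / k * (2 * Re (?a * cnj ?b)) \<le> r ^ k / k * (Re (?a * cnj ?a) + Re (?b * cnj ?b))"
      by (rule mult_left_mono[OF le]) (use r in simp)
    then show "2 * (r ^ k / k * Re (?a * cnj ?b)) \<le> r ^ k / k * Re (?a * cnj ?a) + r ^ k / k * Re (?b * cnj ?b)"
      by (simp only: distrib_left mult.left_commute)
  qed
qed

definition abel_radius :: "nat \<Rightarrow> real" where
  "abel_radius n = 1 - inverse (real (Suc n))"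

lemma abel_radius: "0 \<le> abel_radius n" "abel_radius n < 1" "abel_radius \<longlonglongrightarrow> 1"
proof -
  show "0 \<le> abel_radius n" "abel_radius n < 1" by (auto simp: abel_radius_def field_simps)
  show "abel_radius \<longlonglongrightarrow> 1"
    unfolding abel_radius_def[abs_def]
    by (rule tendsto_eq_intros LIMSEQ_inverse_real_of_nat refl)+ simp
qed

lemma (in circle_prob) finite_log_energy_iff:
  "finite_log_energy \<mu> \<longleftrightarrow> (\<integral>\<^sup>+ p. log_gap p \<partial>(\<mu> \<Otimes>\<^sub>M \<mu>)) < \<top>"
proof -
  interpret circle_prob_pair \<mu> \<mu> ..
  show ?thesis by (simp only: finite_log_energy_def log_integral_gt_iff)
qed

lemma (in circle_prob_pair) finite_gap_of_finite_energies:
  assumes "finite_log_energy \<mu>" "finite_log_energy \<nu>"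
  shows finite_gap
proof -
  interpret A: circle_prob_pair \<mu> \<mu> ..
  interpret B: circle_prob_pair \<nu> \<nu> ..
  have a: "A.finite_gap" "B.finite_gap" using assms M.finite_log_energy_iff N.finite_log_energy_iff by auto
  show ?thesis
  proof (rule finite_gapI[OF abel_radius])
    show "abel_energy (abel_radius n) \<le> ((ln 2 - (\<integral>p. log_norm p \<partial>(\<mu> \<Otimes>\<^sub>M \<mu>))) + (ln 2 - (\<integral>p. log_norm p \<partial>(\<nu> \<Otimes>\<^sub>M \<nu>)))) / 2" for n
      using abel_energy_le_mean[OF abel_radius(1,2)[of n]] A.abel_energy_le[OF a(1) abel_radius(1,2)[of n]]
        B.abel_energy_le[OF a(2) abel_radius(1,2)[of n]] by simp
  qed
qed

text \<open>Finiteness of all four energies makes the extended-real expression an ordinary one. The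
  limit is stated for every sequence of radii because it is later taken along squared radii.\<close>

lemma (in circle_prob_pair) rel_log_energy_limit:
  assumes fin: "finite_log_energy \<mu>" "finite_log_energy \<nu>"
  obtains H where "rel_log_energy \<mu> \<nu> = ereal H"
    "\<And>r. (\<And>n. 0 \<le> r n) \<Longrightarrow> (\<And>n. r n < 1) \<Longrightarrow> r \<longlonglongrightarrow> 1 \<Longrightarrow> (\<lambda>n. abel_rel_energy \<mu> \<nu> (r n)) \<longlonglongrightarrow> H"
proof
  interpret A: circle_prob_pair \<mu> \<mu> ..
  interpret B: circle_prob_pair \<nu> \<nu> ..
  interpret C: circle_prob_pair \<nu> \<mu> ..
  have g: A.finite_gap B.finite_gap finite_gap C.finite_gap
    using fin A.finite_gap_of_finite_energies B.finite_gap_of_finite_energies finite_gap_of_finite_energies C.finite_gap_of_finite_energies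
    by blast+
  let ?I = "\<lambda>\<mu> \<nu>. \<integral>p. log_norm p \<partial>(\<mu> \<Otimes>\<^sub>M \<nu>)"
  let ?H = "- ?I \<mu> \<mu> - (- ?I \<mu> \<nu>) - (- ?I \<nu> \<mu>) + (- ?I \<nu> \<nu>)"
  show "rel_log_energy \<mu> \<nu> = ereal ?H"
    by (simp add: rel_log_energy_def log_integral_finite_gap[OF g(3)] A.log_integral_finite_gap[OF g(1)]
        B.log_integral_finite_gap[OF g(2)] C.log_integral_finite_gap[OF g(4)])
  show "(\<lambda>n. abel_rel_energy \<mu> \<nu> (r n)) \<longlonglongrightarrow> ?H" if r: "\<And>n. 0 \<le> r n" "\<And>n. r n < 1" "r \<longlonglongrightarrow> 1" for r
    unfolding abel_rel_energy_def
    by (intro tendsto_add tendsto_diff A.abel_energy_tendsto B.abel_energy_tendsto C.abel_energy_tendsto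
        abel_energy_tendsto g r)
qed

text \<open>The estimate is proved for the smoothed primitives at radius r < 1, where all series
  converge absolutely, and then passed to the limit on both sides.\<close>

lemma (in circle_prob_pair) height_L2_le_rel_log_energy:
  assumes fin: "finite_log_energy \<mu>" "finite_log_energy \<nu>"
  obtains H where "rel_log_energy \<mu> \<nu> = ereal H"
    "pi * (\<integral>t. (height_difference \<mu> \<nu> t)\<^sup>2 \<partial>restrict_space lborel {0..2*pi}) \<le> H"
proof -
  interpret M': atomless_circle_prob \<mu> by (rule M.atomless_of_finite_log_energy[OF fin(1)])
  interpret N': atomless_circle_prob \<nu> by (rule N.atomless_of_finite_log_energy[OF fin(2)])
  let ?L = "restrict_space lborel {0..2*pi} :: real measure"
  let ?h = "height_difference \<mu> \<nu>"
  interpret L: finite_measure ?L by (rule finite_measure_period)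
  obtain H where H: "rel_log_energy \<mu> \<nu> = ereal H"
    and lim: "\<And>r. (\<And>n. 0 \<le> r n) \<Longrightarrow> (\<And>n. r n < 1) \<Longrightarrow> r \<longlonglongrightarrow> 1 \<Longrightarrow> (\<lambda>n. abel_rel_energy \<mu> \<nu> (r n)) \<longlonglongrightarrow> H"
    by (rule rel_log_energy_limit[OF fin]) blast
  define d where "d k = circle_coeff \<mu> k - circle_coeff \<nu> k" for k
  define a where "a r k = of_real (r ^ k / k) * cnj (d k)" for r k
  define f where "f r t = M.abel_primitive r t - N.abel_primitive r t" for r t
  have f: "(\<lambda>k. a r k * cis (real k * t)) sums f r t" if r: "0 \<le> r" "r < 1" for r t
    using sums_diff[OF M.abel_primitive_sums[OF r, of t] N.abel_primitive_sums[OF r, of t]]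
    by (simp add: a_def d_def f_def left_diff_distrib right_diff_distrib)
  have nd: "norm (d k) \<le> 2" for k
    using norm_triangle_ineq4[of "circle_coeff \<mu> k" "circle_coeff \<nu> k"] M.norm_circle_coeff_le[of k] N.norm_circle_coeff_le[of k]
    by (simp add: d_def)
  have na: "norm (a r k) \<le> 2 * r ^ k" if r: "0 \<le> r" for r k
  proof (cases "k = 0")
    case False
    have "norm (a r k) = r ^ k / k * norm (d k)" using r by (simp add: a_def norm_mult norm_divide norm_power)
    also have "\<dots> \<le> r ^ k / 1 * 2" using r False nd by (intro mult_mono divide_left_mono) auto
    finally show ?thesis by simp
  qed (simp add: a_def)
  have sa: "summable (\<lambda>k. norm (a r k))" if r: "0 \<le> r" "r < 1" for r
    by (rule summable_comparison_test'[where g="\<lambda>k. 2 * r ^ k" and N=0])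
      (use r na in \<open>auto intro!: summable_mult summable_geometric\<close>)
  \<comment> \<open>Squaring the coefficients r^k / k produces (r^2)^k / k^2, so the L^2 norm at
    radius r is compared with the energy at radius r^2; the only loss is 1 / k^2 <= 1 / k.\<close>
  have f_int: "(\<integral>t. (Im (f r t))\<^sup>2 \<partial>?L) \<le> pi * abel_rel_energy \<mu> \<nu> (r\<^sup>2)" and f_meas: "f r \<in> borel_measurable borel"
    if r: "0 \<le> r" "r < 1" for r
  proof -
    note P = integral_Im_trig_series[where a="a r" and f="f r", OF _ sa[OF r] f[OF r]]
    show "f r \<in> borel_measurable borel" by (rule P(1)) (simp add: a_def)
    have r2: "0 \<le> r\<^sup>2" "r\<^sup>2 < 1" using r by (auto simp: power_less_one_iff abs_square_less_1)
    show "(\<integral>t. (Im (f r t))\<^sup>2 \<partial>?L) \<le> pi * abel_rel_energy \<mu> \<nu> (r\<^sup>2)"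
    proof (rule sums_le[OF _ P(2) sums_mult[OF abel_rel_energy_sums[OF r2]]])
      fix k
      show "pi * (norm (a r k))\<^sup>2 \<le> pi * ((r\<^sup>2) ^ k / k * (norm (circle_coeff \<mu> k - circle_coeff \<nu> k))\<^sup>2)"
      proof (cases "k = 0")
        case False
        have "(norm (a r k))\<^sup>2 = (r ^ k)\<^sup>2 / (real k)\<^sup>2 * (norm (d k))\<^sup>2"
          using r by (simp add: a_def norm_mult norm_divide norm_power power_mult_distrib power_divide)
        also have "\<dots> \<le> (r ^ k)\<^sup>2 / real k * (norm (d k))\<^sup>2"
          using False r by (intro mult_right_mono divide_left_mono) (auto simp: power2_eq_square)
        also have "(r ^ k)\<^sup>2 = (r\<^sup>2) ^ k" by (simp add: mult.commute flip: power_mult)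
        finally show ?thesis unfolding d_def by (intro mult_left_mono) simp_all
      qed (simp add: a_def)
    qed (simp add: a_def)
  qed
  have h_meas [measurable]: "?h \<in> borel_measurable borel" unfolding height_difference_def[abs_def] by measurable
  note R = abel_radius(1,2)
  have "(\<lambda>n. \<integral>t. (Im (f (abel_radius n) t))\<^sup>2 \<partial>?L) \<longlonglongrightarrow> (\<integral>t. (pi * ?h t)\<^sup>2 \<partial>?L)"
  proof (rule integral_dominated_convergence)
    show "(\<lambda>t. (pi * ?h t)\<^sup>2) \<in> borel_measurable ?L" by (intro measurable_restrict_space1) simp
    show "(\<lambda>t. (Im (f (abel_radius n) t))\<^sup>2) \<in> borel_measurable ?L" for n
      using f_meas[OF R] by (intro measurable_restrict_space1) simp
    show "integrable ?L (\<lambda>t. (2 * pi)\<^sup>2)" by simp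
    show "AE t in ?L. norm ((Im (f (abel_radius n) t))\<^sup>2) \<le> (2 * pi)\<^sup>2" for n
    proof (rule AE_I2)
      fix t
      have "\<bar>Im (f (abel_radius n) t)\<bar> \<le> 2 * pi"
        using M.abel_primitive_Im_bounded[OF R, of n t] N.abel_primitive_Im_bounded[OF R, of n t] by (simp add: f_def)
      then show "norm ((Im (f (abel_radius n) t))\<^sup>2) \<le> (2 * pi)\<^sup>2"
        using abs_le_square_iff[of "Im (f (abel_radius n) t)" "2 * pi"] by simp
    qed
    \<comment> \<open>The pointwise limit is available only for t < 2 pi; the right endpoint is a
      null set.\<close>
    have "AE t in lborel. t \<noteq> 2 * pi" by (rule AE_lborel_singleton)
    then have "AE t in lborel. t \<in> {0..2*pi} \<longrightarrow> (\<lambda>n. (Im (f (abel_radius n) t))\<^sup>2) \<longlonglongrightarrow> (pi * ?h t)\<^sup>2"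
    proof eventually_elim
      case (elim t)
      show ?case
      proof
        assume "t \<in> {0..2*pi}"
        then have t: "0 \<le> t" "t < 2 * pi" using elim by auto
        have "(\<lambda>n. Im (f (abel_radius n) t)) \<longlonglongrightarrow> (pi * angle_cdf \<mu> t + (mean_angle \<mu> - t - pi) / 2) - (pi * angle_cdf \<nu> t + (mean_angle \<nu> - t - pi) / 2)"
          unfolding f_def minus_complex.sel
          by (intro tendsto_diff M'.abel_primitive_tendsto N'.abel_primitive_tendsto t abel_radius)
        also have "(pi * angle_cdf \<mu> t + (mean_angle \<mu> - t - pi) / 2) - (pi * angle_cdf \<nu> t + (mean_angle \<nu> - t - pi) / 2) = pi * ?h t"
          by (simp add: height_difference_def field_simps)
        finally show "(\<lambda>n. (Im (f (abel_radius n) t))\<^sup>2) \<longlonglongrightarrow> (pi * ?h t)\<^sup>2" by (rule tendsto_power)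
      qed
    qed
    then show "AE t in ?L. (\<lambda>n. (Im (f (abel_radius n) t))\<^sup>2) \<longlonglongrightarrow> (pi * ?h t)\<^sup>2"
      by (subst AE_restrict_space_iff) auto
  qed
  moreover have "(\<lambda>n. pi * abel_rel_energy \<mu> \<nu> ((abel_radius n)\<^sup>2)) \<longlonglongrightarrow> pi * H"
  proof (intro tendsto_mult tendsto_const lim)
    show "(abel_radius n)\<^sup>2 < 1" for n using abel_radius(1,2)[of n] by (simp add: abs_square_less_1)
    show "(\<lambda>n. (abel_radius n)\<^sup>2) \<longlonglongrightarrow> 1" using tendsto_power[OF abel_radius(3), of 2] by simp
  qed simp
  ultimately have "(\<integral>t. (pi * ?h t)\<^sup>2 \<partial>?L) \<le> pi * H"
    by (rule LIMSEQ_le) (use f_int[OF R] in blast)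
  \<comment> \<open>The limit of the imaginary parts is pi times the height difference, so the left
    side carries pi^2, of which one factor cancels.\<close>
  then have "pi * (pi * (\<integral>t. (?h t)\<^sup>2 \<partial>?L)) \<le> pi * H"
    by (simp only: power_mult_distrib integral_mult_right_zero power2_eq_square[of pi] mult.assoc)
  then have "pi * (\<integral>t. (?h t)\<^sup>2 \<partial>?L) \<le> H" by simp
  with H show thesis by (rule that)
qed

section \<open>The strict inequality\<close>

text \<open>\<open>cis\<close> undoes \<open>Arg2pi\<close> on the circle, so the measure can be
  recovered from the law of its angle; this reduces equality of measures to equality of distribution
  functions.\<close>

lemma (in circle_prob) circle_prob_eq_distr:
  "\<mu> = distr (distr \<mu> borel Arg2pi) (restrict_space borel unit_circle) cis"
proof -
  have c: "cis \<in> borel \<rightarrow>\<^sub>M restrict_space borel unit_circle"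
    by (intro measurable_restrict_space2 borel_measurable_continuous_onI continuous_intros) auto
  have "distr (distr \<mu> borel Arg2pi) (restrict_space borel unit_circle) cis
      = distr \<mu> (restrict_space borel unit_circle) (\<lambda>z. cis (Arg2pi z))"
    by (subst distr_distr[OF c]) (auto simp: comp_def)
  also have "\<dots> = distr \<mu> \<mu> (\<lambda>z. z)"
    by (intro distr_cong) (auto simp: cis_Arg2pi norm_circle sets_circle)
  finally show ?thesis by simp
qed

lemma (in circle_prob_pair) eq_of_angle_cdf_eq:
  assumes "angle_cdf \<mu> = angle_cdf \<nu>"
  shows "\<mu> = \<nu>"
proof -
  have "distr \<mu> borel Arg2pi = distr \<nu> borel Arg2pi"
  proof (rule cdf_unique)
    show "real_distribution (distr \<mu> borel Arg2pi)" by (rule M.real_distribution_distr) measurable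
    show "real_distribution (distr \<nu> borel Arg2pi)" by (rule N.real_distribution_distr) measurable
    show "cdf (distr \<mu> borel Arg2pi) = cdf (distr \<nu> borel Arg2pi)"
      using assms by (simp add: M.angle_cdf_eq_cdf N.angle_cdf_eq_cdf)
  qed
  then show ?thesis using M.circle_prob_eq_distr N.circle_prob_eq_distr by metis
qed

lemma integral_period_eq_henstock:
  fixes f :: "real \<Rightarrow> real"
  assumes "continuous_on {0..2*pi} f"
  shows "integrable (restrict_space lborel {0..2*pi}) f"
    and "(\<integral>t. f t \<partial>restrict_space lborel {0..2*pi}) = integral {0..2*pi} f"
proof -
  have i: "set_integrable lborel {0..2*pi} f"
    using assms by (rule borel_integrable_atLeastAtMost')
  then show "integrable (restrict_space lborel {0..2*pi}) f"
    by (simp add: set_integrable_def integrable_restrict_space)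
  show "(\<integral>t. f t \<partial>restrict_space lborel {0..2*pi}) = integral {0..2*pi} f"
    using set_borel_integral_eq_integral(2)[OF i] by (simp add: set_lebesgue_integral_def integral_restrict_space)
qed

lemma measure_period: "measure (restrict_space lborel {0..2*pi}) {0..2*pi} = 2 * pi"
  by (subst measure_restrict_space) auto

text \<open>Expanding the variance of |f| about its mean \<open>c\<close> gives both parts. In the
  equality case the continuous function (|f| - c)^2 has integral 0 and vanishes everywhere, so f
  takes only the values c and -c, and connectedness of the interval leaves one.\<close>

lemma Cauchy_Schwarz_period:
  fixes f :: "real \<Rightarrow> real"
  assumes f: "continuous_on {0..2*pi} f"
  defines "L \<equiv> restrict_space lborel {0..2*pi}"
  shows "(\<integral>t. \<bar>f t\<bar> \<partial>L)\<^sup>2 \<le> 2 * pi * (\<integral>t. (f t)\<^sup>2 \<partial>L)"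
    and "(\<integral>t. \<bar>f t\<bar> \<partial>L)\<^sup>2 = 2 * pi * (\<integral>t. (f t)\<^sup>2 \<partial>L) \<Longrightarrow> f constant_on {0..2*pi}"
proof -
  define c where "c = (\<integral>t. \<bar>f t\<bar> \<partial>L) / (2 * pi)"
  have cont: "continuous_on {0..2*pi} (\<lambda>t. (\<bar>f t\<bar> - c)\<^sup>2)" by (intro continuous_intros f)
  have i1: "integrable L (\<lambda>t. \<bar>f t\<bar>)" and i2: "integrable L (\<lambda>t. (f t)\<^sup>2)"
    unfolding L_def by (intro integral_period_eq_henstock continuous_intros f)+
  interpret finite_measure L unfolding L_def by (rule finite_measure_period)
  have meas: "measure L (space L) = 2 * pi" using measure_period by (simp add: L_def space_restrict_space)
  then have "(\<integral>t. c\<^sup>2 \<partial>L) = 2 * pi * c\<^sup>2" by simp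
  have "(\<integral>t. (\<bar>f t\<bar> - c)\<^sup>2 \<partial>L) = (\<integral>t. ((f t)\<^sup>2 - 2 * c * \<bar>f t\<bar>) + c\<^sup>2 \<partial>L)"
    by (intro Bochner_Integration.integral_cong) (auto simp: power2_eq_square algebra_simps)
  also have "\<dots> = (\<integral>t. (f t)\<^sup>2 \<partial>L) - 2 * c * (\<integral>t. \<bar>f t\<bar> \<partial>L) + (\<integral>t. c\<^sup>2 \<partial>L)"
    using i1 i2 by (subst Bochner_Integration.integral_add) auto
  also have "\<dots> = (\<integral>t. (f t)\<^sup>2 \<partial>L) - (\<integral>t. \<bar>f t\<bar> \<partial>L)\<^sup>2 / (2 * pi)"
    unfolding \<open>(\<integral>t. c\<^sup>2 \<partial>L) = 2 * pi * c\<^sup>2\<close> c_def by (simp add: field_simps power2_eq_square meas)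
  finally have eq: "(\<integral>t. (\<bar>f t\<bar> - c)\<^sup>2 \<partial>L) = (\<integral>t. (f t)\<^sup>2 \<partial>L) - (\<integral>t. \<bar>f t\<bar> \<partial>L)\<^sup>2 / (2 * pi)" .
  have "0 \<le> (\<integral>t. (\<bar>f t\<bar> - c)\<^sup>2 \<partial>L)" by simp
  then show "(\<integral>t. \<bar>f t\<bar> \<partial>L)\<^sup>2 \<le> 2 * pi * (\<integral>t. (f t)\<^sup>2 \<partial>L)"
    unfolding eq by (simp add: field_simps)
  assume "(\<integral>t. \<bar>f t\<bar> \<partial>L)\<^sup>2 = 2 * pi * (\<integral>t. (f t)\<^sup>2 \<partial>L)"
  then have "integral {0..2*pi} (\<lambda>t. (\<bar>f t\<bar> - c)\<^sup>2) = 0"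
    using eq integral_period_eq_henstock(2)[OF cont] by (simp add: L_def)
  then have "\<forall>t\<in>{0..2*pi}. (\<bar>f t\<bar> - c)\<^sup>2 = 0"
    using cont by (subst (asm) integral_eq_0_iff) auto
  then have "f ` {0..2*pi} \<subseteq> {c, -c}" by auto
  then have "finite (f ` {0..2*pi})" by (rule finite_subset) simp
  then show "f constant_on {0..2*pi}"
    by (intro continuous_finite_range_constant f connected_Icc)
qed

text \<open>\<open>D\<close> is the L^1 norm of the height difference. Placing this real number
  between the two sides lets strictness be argued in the reals.\<close>

lemma (in circle_prob_pair) circle_wasserstein_1_less:
  assumes fin: "finite_log_energy \<mu>" "finite_log_energy \<nu>"
  obtains D H where "0 \<le> D" "circle_wasserstein 1 \<mu> \<nu> \<le> ennreal D" "rel_log_energy \<mu> \<nu> = ereal H"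
    "D\<^sup>2 \<le> 2 * H" "\<mu> \<noteq> \<nu> \<Longrightarrow> D\<^sup>2 < 2 * H"
proof -
  interpret M': atomless_circle_prob \<mu> by (rule M.atomless_of_finite_log_energy[OF fin(1)])
  interpret N': atomless_circle_prob \<nu> by (rule N.atomless_of_finite_log_energy[OF fin(2)])
  let ?L = "restrict_space lborel {0..2*pi} :: real measure"
  let ?h = "height_difference \<mu> \<nu>"
  let ?D = "\<integral>t. \<bar>?h t\<bar> \<partial>?L"
  obtain H where H: "rel_log_energy \<mu> \<nu> = ereal H" "pi * (\<integral>t. (?h t)\<^sup>2 \<partial>?L) \<le> H"
    by (rule height_L2_le_rel_log_energy[OF fin]) blast
  have cont: "continuous_on {0..2*pi} ?h"
    unfolding height_difference_def[abs_def]
    by (intro continuous_intros M'.continuous_angle_cdf N'.continuous_angle_cdf)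
  have "continuous_on {0..2*pi} (\<lambda>t. \<bar>?h t\<bar>)" by (intro continuous_intros cont)
  then have int: "integrable ?L (\<lambda>t. \<bar>?h t\<bar>)" by (rule integral_period_eq_henstock)
  have "circle_wasserstein 1 \<mu> \<nu> \<le> (\<integral>\<^sup>+ t. ennreal \<bar>?h t\<bar> * indicator {0..2*pi} t \<partial>lborel)"
    unfolding height_difference_def
    by (rule circle_wasserstein_1_le[OF M'.atomless_circle_prob_axioms N'.atomless_circle_prob_axioms])
  also have "\<dots> = (\<integral>\<^sup>+ t. ennreal \<bar>?h t\<bar> \<partial>?L)"
    by (subst nn_integral_restrict_space) auto
  also have "\<dots> = ennreal ?D" using int by (intro nn_integral_eq_integral) auto
  finally have W: "circle_wasserstein 1 \<mu> \<nu> \<le> ennreal ?D" .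
  note CS = Cauchy_Schwarz_period[OF cont]
  have "?D\<^sup>2 < 2 * H" if "\<mu> \<noteq> \<nu>"
  proof (rule ccontr)
    assume "\<not> ?D\<^sup>2 < 2 * H"
    \<comment> \<open>The chain D^2 <= 2 pi |h|_2^2 <= 2 H <= D^2 collapses, so Cauchy-Schwarz holds
      with equality.\<close>
    then have "?h constant_on {0..2*pi}" using CS H(2) by (intro CS(2)) linarith
    then obtain c where c: "\<And>t. t \<in> {0..2*pi} \<Longrightarrow> ?h t = c" by (auto simp: constant_on_def)
    have "angle_cdf \<mu> t = angle_cdf \<nu> t" for t
    proof -
      \<comment> \<open>Both distribution functions vanish at 0, so a constant height difference
        leaves F - G = 0.\<close>
      have "?h t = ?h 0 \<Longrightarrow> angle_cdf \<mu> t = angle_cdf \<nu> t"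
        by (simp add: height_difference_def M'.angle_cdf_0 N'.angle_cdf_0)
      moreover have "angle_cdf \<mu> t = 0" "angle_cdf \<nu> t = 0" if "t \<le> 0"
        using M.angle_cdf_mono[OF that] N.angle_cdf_mono[OF that] M.angle_cdf_bounds(1)[of t] N.angle_cdf_bounds(1)[of t]
          M'.angle_cdf_0 N'.angle_cdf_0 by auto
      ultimately show ?thesis
        using c[of t] c[of 0] M.angle_cdf_2pi[of t] N.angle_cdf_2pi[of t] by (cases "t \<le> 0"; cases "2 * pi \<le> t") auto
    qed
    then show False using eq_of_angle_cdf_eq that by blast
  qed
  moreover have "?D\<^sup>2 \<le> 2 * H" using CS(1) H(2) by linarith
  moreover have "0 \<le> ?D" by simp
  ultimately show thesis using that W H(1) by blast
qed

lemma circle_prob_pairI: "\<mu> \<in> circle_probs \<Longrightarrow> \<nu> \<in> circle_probs \<Longrightarrow> circle_prob_pair \<mu> \<nu>"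
  by (simp add: circle_probs_def circle_prob_pair_def circle_prob_def circle_prob_axioms_def)

theorem circle_wasserstein_1_rel_log_energy:
  assumes "\<mu> \<in> circle_probs" "\<nu> \<in> circle_probs" "finite_log_energy \<mu>" "finite_log_energy \<nu>"
  shows "enn2ereal ((circle_wasserstein 1 \<mu> \<nu>)\<^sup>2) \<le> 2 * rel_log_energy \<mu> \<nu>"
    and "\<mu> \<noteq> \<nu> \<Longrightarrow> enn2ereal ((circle_wasserstein 1 \<mu> \<nu>)\<^sup>2) < 2 * rel_log_energy \<mu> \<nu>"
proof -
  interpret circle_prob_pair \<mu> \<nu> by (rule circle_prob_pairI[OF assms(1,2)])
  obtain D H where *: "0 \<le> D" "circle_wasserstein 1 \<mu> \<nu> \<le> ennreal D" "rel_log_energy \<mu> \<nu> = ereal H"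
    "D\<^sup>2 \<le> 2 * H" "\<mu> \<noteq> \<nu> \<Longrightarrow> D\<^sup>2 < 2 * H"
    by (rule circle_wasserstein_1_less[OF assms(3,4)]) blast
  have "(circle_wasserstein 1 \<mu> \<nu>)\<^sup>2 \<le> (ennreal D)\<^sup>2"
    using *(2) by (rule power_mono) simp
  also have "\<dots> = ennreal (D\<^sup>2)" by (rule ennreal_power[OF *(1)])
  finally have le: "enn2ereal ((circle_wasserstein 1 \<mu> \<nu>)\<^sup>2) \<le> ereal (D\<^sup>2)"
    by (simp add: less_eq_ennreal.rep_eq)
  show "enn2ereal ((circle_wasserstein 1 \<mu> \<nu>)\<^sup>2) \<le> 2 * rel_log_energy \<mu> \<nu>"
    using le *(3,4) by (auto intro: order_trans)
  show "enn2ereal ((circle_wasserstein 1 \<mu> \<nu>)\<^sup>2) < 2 * rel_log_energy \<mu> \<nu>" if "\<mu> \<noteq> \<nu>"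
    using le *(3) *(5)[OF that] by (auto intro: order.strict_trans1)
qed

section \<open>Mixtures and equilibrium measures\<close>

text \<open>The convex combination s \<mu> + (1 - s) \<nu>, realized by first drawing a Bernoulli
  variable; the integration rules for \<open>bind\<close> then give affinity in s.\<close>

definition mixture :: "real \<Rightarrow> complex measure \<Rightarrow> complex measure \<Rightarrow> complex measure" where
  "mixture s \<mu> \<nu> = measure_pmf (bernoulli_pmf s) \<bind> (\<lambda>b. if b then \<mu> else \<nu>)"

context circle_prob_pair
begin

lemma mixture_kernel:
  "(\<lambda>b. if b then \<mu> else \<nu>) \<in> measure_pmf (bernoulli_pmf s) \<rightarrow>\<^sub>M subprob_algebra (restrict_space borel unit_circle)"
proof -
  have "\<mu> \<in> space (subprob_algebra (restrict_space borel unit_circle))" "\<nu> \<in> space (subprob_algebra (restrict_space borel unit_circle))"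
    unfolding space_subprob_algebra mem_Collect_eq
    by (intro conjI prob_space_imp_subprob_space M.prob_space_axioms N.prob_space_axioms M.sets_circle N.sets_circle)+
  then show ?thesis by simp
qed

lemma sets_mixture: "sets (mixture s \<mu> \<nu>) = sets (restrict_space borel unit_circle)"
  unfolding mixture_def
proof (rule sets_bind)
  show "sets (if b then \<mu> else \<nu>) = sets (restrict_space borel unit_circle)" for b
    by (cases b) (simp_all only: if_True if_False M.sets_circle N.sets_circle)
qed simp

lemma nn_integral_mixture:
  assumes s: "0 \<le> s" "s \<le> 1" and f: "f \<in> borel_measurable (restrict_space borel unit_circle)"
  shows "(\<integral>\<^sup>+ z. f z \<partial>mixture s \<mu> \<nu>) = ennreal s * (\<integral>\<^sup>+ z. f z \<partial>\<mu>) + ennreal (1 - s) * (\<integral>\<^sup>+ z. f z \<partial>\<nu>)"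
  unfolding mixture_def by (subst nn_integral_bind[OF f mixture_kernel]) (simp add: s mult.commute)

lemma circle_prob_mixture:
  assumes s: "0 \<le> s" "s \<le> 1"
  shows "circle_prob (mixture s \<mu> \<nu>)"
proof (intro circle_prob.intro circle_prob_axioms.intro prob_spaceI)
  have "(\<integral>\<^sup>+ z. 1 \<partial>mixture s \<mu> \<nu>) = ennreal s + ennreal (1 - s)"
    by (subst nn_integral_mixture[OF s]) (auto simp: M.emeasure_space_1 N.emeasure_space_1)
  also have "\<dots> = 1" using s by (simp add: ennreal_plus[symmetric] del: ennreal_plus)
  finally show "emeasure (mixture s \<mu> \<nu>) (space (mixture s \<mu> \<nu>)) = 1" by simp
qed (rule sets_mixture)

lemma integral_mixture:
  fixes f :: "complex \<Rightarrow> real"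
  assumes s: "0 \<le> s" "s \<le> 1" and f: "f \<in> borel_measurable (restrict_space borel unit_circle)"
    and B: "\<And>z. norm z = 1 \<Longrightarrow> \<bar>f z\<bar> \<le> B"
  shows "(\<integral>z. f z \<partial>mixture s \<mu> \<nu>) = s * (\<integral>z. f z \<partial>\<mu>) + (1 - s) * (\<integral>z. f z \<partial>\<nu>)"
proof -
  have "(\<integral>z. f z \<partial>mixture s \<mu> \<nu>) = (\<integral>b. (\<integral>z. f z \<partial>(if b then \<mu> else \<nu>)) \<partial>measure_pmf (bernoulli_pmf s))"
    unfolding mixture_def
  proof (rule integral_bind[OF f _ mixture_kernel, where B=B and B'=1])
    show "\<bar>f z\<bar> \<le> B" if "z \<in> space (restrict_space borel unit_circle)" for z
      using that by (simp add: space_restrict_space B)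
    show "AE b in measure_pmf (bernoulli_pmf s). emeasure (if b then \<mu> else \<nu>) (space (if b then \<mu> else \<nu>)) \<le> ennreal 1"
      by (intro AE_I2) (auto simp: M.emeasure_space_1 N.emeasure_space_1)
  qed unfold_locales
  then show ?thesis by (simp add: s mult.commute)
qed

end

abbreviation gap_energy :: "complex measure \<Rightarrow> complex measure \<Rightarrow> ennreal" where
  "gap_energy \<mu> \<nu> \<equiv> (\<integral>\<^sup>+ p. log_gap p \<partial>(\<mu> \<Otimes>\<^sub>M \<nu>))"

lemma (in circle_prob_pair) log_integral_eq_gap_energy:
  assumes finite_gap
  shows "log_integral \<mu> \<nu> = ereal (ln 2 - enn2real (gap_energy \<mu> \<nu>))"
proof -
  have "(\<integral>p. log_norm p \<partial>(\<mu> \<Otimes>\<^sub>M \<nu>)) \<le> (\<integral>p. ln 2 \<partial>(\<mu> \<Otimes>\<^sub>M \<nu>))"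
    using finite_gap_integrable(1)[OF assms] log_norm_le by (intro integral_mono) auto
  then show ?thesis
    using prob_space by (simp add: log_integral_finite_gap[OF assms] finite_gap_integrable(2)[OF assms])
qed

lemma log_gap_measurable_circle:
  "(\<lambda>p. log_gap p) \<in> borel_measurable (restrict_space borel unit_circle \<Otimes>\<^sub>M restrict_space borel unit_circle)"
proof -
  have id: "(\<lambda>z. z) \<in> (restrict_space borel unit_circle :: complex measure) \<rightarrow>\<^sub>M borel"
    by (rule measurable_restrict_space1) simp
  have [measurable]: "fst \<in> (restrict_space borel unit_circle \<Otimes>\<^sub>M restrict_space borel unit_circle :: (complex \<times> complex) measure) \<rightarrow>\<^sub>M borel"
    "snd \<in> (restrict_space borel unit_circle \<Otimes>\<^sub>M restrict_space borel unit_circle :: (complex \<times> complex) measure) \<rightarrow>\<^sub>M borel"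
    by (rule measurable_compose[OF measurable_fst id], rule measurable_compose[OF measurable_snd id])
  show ?thesis unfolding log_gap_def log_norm_def by measurable
qed

context circle_prob_pair
begin

lemma nn_integral_log_gap_measurable:
  assumes "circle_prob \<rho>"
  shows "(\<lambda>z. \<integral>\<^sup>+ w. log_gap (z, w) \<partial>\<rho>) \<in> borel_measurable (restrict_space borel unit_circle)"
proof -
  interpret R: circle_prob \<rho> by fact
  have "log_gap \<in> borel_measurable (restrict_space borel unit_circle \<Otimes>\<^sub>M \<rho>)"
    using log_gap_measurable_circle by (subst measurable_cong_sets[OF sets_pair_measure_cong[OF refl R.sets_circle] refl])
  then show ?thesis by (rule R.borel_measurable_nn_integral_fst)
qed

lemma log_gap_section_measurable:
  assumes "norm z = 1"
  shows "(\<lambda>w. log_gap (z, w)) \<in> borel_measurable (restrict_space borel unit_circle)"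
  by (rule measurable_compose[OF measurable_Pair1' log_gap_measurable_circle]) (use assms in \<open>simp add: space_restrict_space\<close>)

lemma gap_energy_iterated: "gap_energy \<mu> \<nu> = (\<integral>\<^sup>+ z. \<integral>\<^sup>+ w. log_gap (z, w) \<partial>\<nu> \<partial>\<mu>)"
  by (rule N.nn_integral_fst[symmetric]) measurable

text \<open>As the gap is nonnegative, iterated integrals and sums may be split without finiteness
  assumptions.\<close>

lemma gap_energy_mixture_right:
  assumes "circle_prob \<rho>" and s: "0 \<le> s" "s \<le> 1"
  shows "gap_energy \<rho> (mixture s \<mu> \<nu>) = ennreal s * gap_energy \<rho> \<mu> + ennreal (1 - s) * gap_energy \<rho> \<nu>"
proof -
  interpret R: circle_prob \<rho> by fact
  interpret X: circle_prob "mixture s \<mu> \<nu>" by (rule circle_prob_mixture[OF s])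
  interpret RX: circle_prob_pair \<rho> "mixture s \<mu> \<nu>" ..
  interpret RM: circle_prob_pair \<rho> \<mu> ..
  interpret RN: circle_prob_pair \<rho> \<nu> ..
  have [measurable]: "(\<lambda>z. \<integral>\<^sup>+ w. log_gap (z, w) \<partial>\<mu>) \<in> borel_measurable \<rho>" "(\<lambda>z. \<integral>\<^sup>+ w. log_gap (z, w) \<partial>\<nu>) \<in> borel_measurable \<rho>"
    using nn_integral_log_gap_measurable[OF M.circle_prob_axioms] nn_integral_log_gap_measurable[OF N.circle_prob_axioms]
    by (simp_all add: measurable_cong_sets[OF R.sets_circle refl])
  have "gap_energy \<rho> (mixture s \<mu> \<nu>) = (\<integral>\<^sup>+ z. ennreal s * (\<integral>\<^sup>+ w. log_gap (z, w) \<partial>\<mu>) + ennreal (1 - s) * (\<integral>\<^sup>+ w. log_gap (z, w) \<partial>\<nu>) \<partial>\<rho>)"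
    unfolding RX.gap_energy_iterated
    by (intro nn_integral_cong nn_integral_mixture[OF s] log_gap_section_measurable R.norm_circle)
  then show ?thesis
    unfolding RM.gap_energy_iterated RN.gap_energy_iterated by (simp add: nn_integral_add nn_integral_cmult)
qed

lemma gap_energy_mixture_left:
  assumes "circle_prob \<rho>" and s: "0 \<le> s" "s \<le> 1"
  shows "gap_energy (mixture s \<mu> \<nu>) \<rho> = ennreal s * gap_energy \<mu> \<rho> + ennreal (1 - s) * gap_energy \<nu> \<rho>"
proof -
  interpret R: circle_prob \<rho> by fact
  interpret X: circle_prob "mixture s \<mu> \<nu>" by (rule circle_prob_mixture[OF s])
  interpret XR: circle_prob_pair "mixture s \<mu> \<nu>" \<rho> ..
  interpret MR: circle_prob_pair \<mu> \<rho> ..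
  interpret NR: circle_prob_pair \<nu> \<rho> ..
  show ?thesis
    unfolding XR.gap_energy_iterated MR.gap_energy_iterated NR.gap_energy_iterated
    by (rule nn_integral_mixture[OF s nn_integral_log_gap_measurable[OF assms(1)]])
qed

text \<open>The energy along the segment is a polynomial of degree at most two in \<open>s\<close>,
  with real coefficients since the mutual energies are finite too; the constant ln 2 is preserved
  because the mixture has mass 1.\<close>

lemma log_integral_mixture:
  assumes s: "0 \<le> s" "s \<le> 1" and fin: "finite_log_energy \<mu>" "finite_log_energy \<nu>"
  shows "log_integral (mixture s \<mu> \<nu>) (mixture s \<mu> \<nu>) = ereal (ln 2 -
    (s * (s * enn2real (gap_energy \<mu> \<mu>) + (1 - s) * enn2real (gap_energy \<mu> \<nu>))
      + (1 - s) * (s * enn2real (gap_energy \<nu> \<mu>) + (1 - s) * enn2real (gap_energy \<nu> \<nu>))))"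
proof -
  interpret X: circle_prob "mixture s \<mu> \<nu>" by (rule circle_prob_mixture[OF s])
  interpret XX: circle_prob_pair "mixture s \<mu> \<nu>" "mixture s \<mu> \<nu>" ..
  interpret A: circle_prob_pair \<mu> \<mu> ..
  interpret B: circle_prob_pair \<nu> \<nu> ..
  interpret C: circle_prob_pair \<nu> \<mu> ..
  have g: A.finite_gap B.finite_gap finite_gap C.finite_gap
    using fin A.finite_gap_of_finite_energies B.finite_gap_of_finite_energies finite_gap_of_finite_energies C.finite_gap_of_finite_energies
    by blast+
  define a b c d where "a = enn2real (gap_energy \<mu> \<mu>)" and "b = enn2real (gap_energy \<mu> \<nu>)"
    and "c = enn2real (gap_energy \<nu> \<mu>)" and "d = enn2real (gap_energy \<nu> \<nu>)"
  then have e: "gap_energy \<mu> \<mu> = ennreal a" "gap_energy \<mu> \<nu> = ennreal b" "gap_energy \<nu> \<mu> = ennreal c" "gap_energy \<nu> \<nu> = ennreal d"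
    using g by simp_all
  have nn: "0 \<le> a" "0 \<le> b" "0 \<le> c" "0 \<le> d" by (simp_all add: a_def b_def c_def d_def)
  have G: "gap_energy (mixture s \<mu> \<nu>) (mixture s \<mu> \<nu>) = ennreal (s * (s * a + (1 - s) * b) + (1 - s) * (s * c + (1 - s) * d))"
    unfolding gap_energy_mixture_left[OF X.circle_prob_axioms s]
      gap_energy_mixture_right[OF M.circle_prob_axioms s] gap_energy_mixture_right[OF N.circle_prob_axioms s] e
    using s nn by (simp add: ennreal_mult ennreal_plus)
  have fg: "XX.finite_gap" unfolding G by simp
  have tot: "0 \<le> s * (s * a + (1 - s) * b) + (1 - s) * (s * c + (1 - s) * d)" using s nn by simp
  show ?thesis
    unfolding XX.log_integral_eq_gap_energy[OF fg] G enn2real_ennreal[OF tot] unfolding a_def b_def c_def d_def ..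
qed

end

text \<open>Serves as a competitor of finite energy, which forces every minimizer to have finite
  energy.\<close>

definition uniform_circle :: "complex measure" where
  "uniform_circle = distr (density (restrict_space lborel {0..2*pi}) (\<lambda>_. ennreal (1 / (2 * pi)))) (restrict_space borel unit_circle) cis"

lemma cis_measurable_circle: "cis \<in> density (restrict_space lborel {0..2*pi}) g \<rightarrow>\<^sub>M restrict_space borel unit_circle"
proof -
  have "cis \<in> (restrict_space lborel {0..2*pi}) \<rightarrow>\<^sub>M restrict_space borel unit_circle"
    by (intro measurable_restrict_space1 measurable_restrict_space2)
      (auto intro!: borel_measurable_continuous_onI continuous_intros)
  then show ?thesis by simp
qed

lemma circle_prob_uniform: "circle_prob uniform_circle"
proof -
  have "emeasure (restrict_space lborel {0..2*pi}) {0..2*pi} = ennreal (2 * pi)"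
    by (subst emeasure_restrict_space) auto
  moreover have "{0..2*pi} \<in> sets (restrict_space lborel {0..2*pi})"
    by (simp add: sets_restrict_space_iff)
  ultimately have "prob_space (density (restrict_space lborel {0..2*pi}) (\<lambda>_. ennreal (1 / (2 * pi))))"
    by (intro prob_spaceI) (simp add: emeasure_density_const space_restrict_space ennreal_mult'[symmetric])
  then have "prob_space uniform_circle"
    unfolding uniform_circle_def by (rule prob_space.prob_space_distr) (rule cis_measurable_circle)
  then show ?thesis by (simp add: circle_prob_def circle_prob_axioms_def uniform_circle_def)
qed

lemma circle_coeff_uniform: "k \<noteq> 0 \<Longrightarrow> circle_coeff uniform_circle k = 0"
proof -
  assume "k \<noteq> 0"
  have "(\<lambda>z. z ^ k) \<in> borel_measurable (restrict_space borel unit_circle :: complex measure)"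
    by (rule measurable_restrict_space1) measurable
  then have "circle_coeff uniform_circle k = (\<integral>t. cis t ^ k \<partial>density (restrict_space lborel {0..2*pi}) (\<lambda>_. ennreal (1 / (2 * pi))))"
    unfolding circle_coeff_def uniform_circle_def by (intro integral_distr cis_measurable_circle)
  also have "\<dots> = (\<integral>t. (1 / (2 * pi)) *\<^sub>R cis t ^ k \<partial>restrict_space lborel {0..2*pi})"
    by (intro integral_density measurable_restrict_space1)
      (auto intro!: borel_measurable_continuous_onI continuous_intros)
  also have "\<dots> = (1 / (2 * pi)) *\<^sub>R (\<integral>t. cis (of_int (int k) * t) \<partial>restrict_space lborel {0..2*pi})"
    by (simp add: Complex.DeMoivre)
  also have "\<dots> = 0" unfolding integral_cis_period using \<open>k \<noteq> 0\<close> by simp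
  finally show ?thesis .
qed

text \<open>All Abel means of the energy of the uniform measure vanish.\<close>

lemma finite_log_energy_uniform: "finite_log_energy uniform_circle"
proof -
  interpret U: circle_prob uniform_circle by (rule circle_prob_uniform)
  interpret circle_prob_pair uniform_circle uniform_circle ..
  have "abel_energy r = 0" if "0 \<le> r" "r < 1" for r
  proof -
    have "r ^ k / k * Re (circle_coeff uniform_circle k * cnj (circle_coeff uniform_circle k)) = 0" for k
      using circle_coeff_uniform[of k] by (cases "k = 0") simp_all
    then have "(\<lambda>k. 0) sums abel_energy r" using abel_energy_sums[OF that] by (simp only:)
    then show ?thesis using sums_unique2[OF sums_zero] by metis
  qed
  then have finite_gap
    using abel_radius(1,2) by (intro finite_gapI[OF abel_radius, where C=0]) simp
  then show ?thesis by (simp add: U.finite_log_energy_iff)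
qed

text \<open>After division by s > 0 the quadratic term is of order s, and the limit at 0 from the
  right leaves the slope.\<close>

lemma slope_nonneg_of_quadratic_min:
  fixes l q :: real
  assumes "\<And>s. 0 < s \<Longrightarrow> s \<le> 1 \<Longrightarrow> 0 \<le> s * l + s\<^sup>2 * q"
  shows "0 \<le> l"
proof (rule tendsto_lowerbound)
  show "((\<lambda>s. l + s * q) \<longlongrightarrow> l) (at_right 0)" by (auto intro!: tendsto_eq_intros)
  have "\<forall>\<^sub>F s in at_right (0::real). s \<in> {0<..<1}" by (rule eventually_at_right_real) simp
  then show "\<forall>\<^sub>F s in at_right 0. 0 \<le> l + s * q"
  proof eventually_elim
    case (elim s)
    then have "0 \<le> s * (l + s * q)" using assms[of s] by (simp add: power2_eq_square algebra_simps)
    then show ?case using elim by (simp add: zero_le_mult_iff)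
  qed
qed simp

text \<open>The first two conclusions concern only the minimizer, so any \<open>\<mu>\<close> of
  finite energy supplies them; the uniform measure is taken when the given measure has infinite
  energy.\<close>

theorem rel_log_energy_le_potential_energy:
  assumes \<mu>: "\<mu> \<in> circle_probs" and Q: "continuous_on unit_circle Q" and eq: "equilibrium_measure Q \<nu>"
    and fin: "finite_log_energy \<mu>"
  shows "\<nu> \<in> circle_probs" and "finite_log_energy \<nu>"
    and "rel_log_energy \<mu> \<nu> \<le> potential_energy Q \<mu> - potential_energy Q \<nu>"
proof -
  show \<nu>: "\<nu> \<in> circle_probs" using eq by (simp add: equilibrium_measure_def is_arg_min_def)
  have min: "potential_energy Q \<nu> \<le> potential_energy Q \<rho>" if "circle_prob \<rho>" for \<rho>
    using eq that by (auto simp: equilibrium_measure_def is_arg_min_def circle_probs_def circle_prob_def circle_prob_axioms_def not_less)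
  interpret circle_prob_pair \<mu> \<nu> by (rule circle_prob_pairI[OF \<mu> \<nu>])
  interpret A: circle_prob_pair \<mu> \<mu> ..
  interpret B: circle_prob_pair \<nu> \<nu> ..
  interpret C: circle_prob_pair \<nu> \<mu> ..
  show fin': "finite_log_energy \<nu>"
  proof (rule ccontr)
    \<comment> \<open>A minimizer of infinite energy would have infinite potential energy, hence so
      would \<open>\<mu>\<close>, against its finite energy.\<close>
    assume "\<not> finite_log_energy \<nu>"
    then have "log_integral \<nu> \<nu> = - \<infinity>" by (simp add: finite_log_energy_def)
    then have "potential_energy Q \<mu> = \<infinity>"
      using min[OF M.circle_prob_axioms] by (simp add: potential_energy_def)
    moreover have "log_integral \<mu> \<mu> \<noteq> - \<infinity>" using fin by (simp add: finite_log_energy_def)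
    ultimately show False by (cases "log_integral \<mu> \<mu>") (auto simp: potential_energy_def)
  qed
  have g: A.finite_gap B.finite_gap finite_gap C.finite_gap
    using fin fin' A.finite_gap_of_finite_energies B.finite_gap_of_finite_energies finite_gap_of_finite_energies C.finite_gap_of_finite_energies
    by blast+
  define a b c d where "a = enn2real (gap_energy \<mu> \<mu>)" and "b = enn2real (gap_energy \<mu> \<nu>)"
    and "c = enn2real (gap_energy \<nu> \<mu>)" and "d = enn2real (gap_energy \<nu> \<nu>)"
  note L = A.log_integral_eq_gap_energy[OF g(1)] B.log_integral_eq_gap_energy[OF g(2)]
    log_integral_eq_gap_energy[OF g(3)] C.log_integral_eq_gap_energy[OF g(4)]
  define x y where "x = (\<integral>z. Q z \<partial>\<mu>)" and "y = (\<integral>z. Q z \<partial>\<nu>)"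
  have Qm: "Q \<in> borel_measurable (restrict_space borel unit_circle)"
    using Q by (rule borel_measurable_continuous_on_restrict)
  have "bounded (Q ` unit_circle)" using Q by (intro compact_imp_bounded compact_continuous_image) auto
  then obtain K where "\<forall>q\<in>Q ` unit_circle. norm q \<le> K" unfolding bounded_iff by blast
  then have K: "\<bar>Q z\<bar> \<le> K" if "norm z = 1" for z using that by auto
  \<comment> \<open>This is the derivative at s = 0 of the potential energy along the segment from
    \<open>\<nu>\<close> to \<open>\<mu>\<close>. The coefficient of s^2 is a - b - c + d, the
    relative energy; in it the constants ln 2 cancel.\<close>
  have "0 \<le> (x - y) + (b + c - 2 * d)"
  proof (rule slope_nonneg_of_quadratic_min)
    fix s :: real assume "0 < s" and s: "s \<le> 1"
    then have s0: "0 \<le> s" by simp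
    have m: "(\<integral>z. Q z \<partial>mixture s \<mu> \<nu>) = s * x + (1 - s) * y"
      unfolding x_def y_def by (rule integral_mixture[OF s0 s Qm K])
    show "0 \<le> s * ((x - y) + (b + c - 2 * d)) + s\<^sup>2 * (a - b - c + d)"
      using min[OF circle_prob_mixture[OF s0 s]]
      unfolding potential_energy_def m log_integral_mixture[OF s0 s fin fin'] L
      by (simp add: a_def[symmetric] b_def[symmetric] c_def[symmetric] d_def[symmetric] x_def[symmetric] y_def[symmetric]
          algebra_simps power2_eq_square)
  qed
  \<comment> \<open>At s = 1 the increase of the potential energy is slope plus relative energy, and
    the slope is nonnegative.\<close>
  then show "rel_log_energy \<mu> \<nu> \<le> potential_energy Q \<mu> - potential_energy Q \<nu>"
    unfolding potential_energy_def rel_log_energy_def L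
    by (simp add: a_def[symmetric] b_def[symmetric] c_def[symmetric] d_def[symmetric] x_def[symmetric] y_def[symmetric])
qed

theorem theorem12:
  shows "(\<forall>\<mu> \<in> circle_probs. \<forall>\<nu> \<in> circle_probs.
            finite_log_energy \<mu> \<and> finite_log_energy \<nu> \<longrightarrow>
              enn2ereal ((circle_wasserstein 1 \<mu> \<nu>)\<^sup>2) \<le> 2 * rel_log_energy \<mu> \<nu> \<and>
              (\<mu> \<noteq> \<nu> \<longrightarrow> enn2ereal ((circle_wasserstein 1 \<mu> \<nu>)\<^sup>2) \<noteq> 2 * rel_log_energy \<mu> \<nu>))
       \<and> (\<forall>Q :: complex \<Rightarrow> real. \<forall>\<mu> \<in> circle_probs. \<forall>\<mu>\<^sub>Q.
            continuous_on unit_circle Q \<and> equilibrium_measure Q \<mu>\<^sub>Q \<longrightarrow>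
              enn2ereal ((circle_wasserstein 1 \<mu> \<mu>\<^sub>Q)\<^sup>2)
                \<le> 2 * (potential_energy Q \<mu> - potential_energy Q \<mu>\<^sub>Q))"
proof (intro conjI ballI allI impI)
  fix \<mu> \<nu> :: "complex measure"
  assume "\<mu> \<in> circle_probs" "\<nu> \<in> circle_probs" "finite_log_energy \<mu> \<and> finite_log_energy \<nu>"
  then show "enn2ereal ((circle_wasserstein 1 \<mu> \<nu>)\<^sup>2) \<le> 2 * rel_log_energy \<mu> \<nu>"
    and "\<mu> \<noteq> \<nu> \<Longrightarrow> enn2ereal ((circle_wasserstein 1 \<mu> \<nu>)\<^sup>2) \<noteq> 2 * rel_log_energy \<mu> \<nu>"
    using circle_wasserstein_1_rel_log_energy[of \<mu> \<nu>] by auto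
next
  fix Q :: "complex \<Rightarrow> real" and \<mu> \<nu> :: "complex measure"
  assume \<mu>: "\<mu> \<in> circle_probs" and "continuous_on unit_circle Q \<and> equilibrium_measure Q \<nu>"
  then have Q: "continuous_on unit_circle Q" and eq: "equilibrium_measure Q \<nu>" by auto
  have "uniform_circle \<in> circle_probs"
    using circle_prob_uniform by (simp add: circle_probs_def circle_prob_def circle_prob_axioms_def)
  \<comment> \<open>With the uniform measure as competitor, the minimizer has finite energy
    independently of the given \<open>\<mu>\<close>.\<close>
  note \<nu> = rel_log_energy_le_potential_energy(1,2)[OF this Q eq finite_log_energy_uniform]
  show "enn2ereal ((circle_wasserstein 1 \<mu> \<nu>)\<^sup>2) \<le> 2 * (potential_energy Q \<mu> - potential_energy Q \<nu>)"
  proof (cases "finite_log_energy \<mu>")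
    case True
    have "enn2ereal ((circle_wasserstein 1 \<mu> \<nu>)\<^sup>2) \<le> 2 * rel_log_energy \<mu> \<nu>"
      by (rule circle_wasserstein_1_rel_log_energy(1)[OF \<mu> \<nu>(1) True \<nu>(2)])
    also have "\<dots> \<le> 2 * (potential_energy Q \<mu> - potential_energy Q \<nu>)"
      by (intro ereal_mult_left_mono rel_log_energy_le_potential_energy(3)[OF \<mu> Q eq True]) simp
    finally show ?thesis .
  next
    case False
    \<comment> \<open>If \<open>\<mu>\<close> has infinite energy, the right side is infinity minus
      a real number, so any value of the distance is allowed.\<close>
    interpret circle_prob_pair \<nu> \<nu> by (rule circle_prob_pairI[OF \<nu>(1,1)])
    have "finite_gap" using \<nu>(2) by (simp only: M.finite_log_energy_iff)
    then obtain e where "potential_energy Q \<nu> = ereal e"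
      by (simp add: potential_energy_def log_integral_finite_gap)
    moreover have "potential_energy Q \<mu> = \<infinity>"
      using False by (simp add: finite_log_energy_def potential_energy_def)
    ultimately show ?thesis by simp
  qed
qed

end
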